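(* Let $n\ge 1$, fix distinct real numbers $\Lambda_0=\{\lambda_1,\dots,\lambda_n\}$, and let $\mathcal M^{\mathrm{fr}}_{\text{s-reg}}$ be the strongly regular locus of the framed space $\mathcal M^{\mathrm{fr}}_{\Lambda_0}$ of triples $(A,F,B)$, identified with pairs $(g,B)$ via the symplectomorphism $\Psi(A,F,B)=(g_F,B)\in T^*U(n)$. Write $G=g=g_F$. Then the spectral curve degenerating system is a double Gelfand--Zeitlin system: the map $$\phi_{\mathrm{spec}}:\mathcal M^{\mathrm{fr}}_{\text{s-reg}}\to \mathfrak G^{\perp},\qquad (g,B)\mapsto\bigl(\mu(GBG^{-1}),\,\mu(-B)\bigr),$$ is well defined (takes values in $\mathfrak G^\perp$) and is the double Gelfand--Zeitlin system on the strongly regular locus of $T^*U(n)$ transported by $\Psi$. Here $\mu=(\mu^{(n)},\dots,\mu^{(1)})$ and $\mu^{(k)}=(\mu^{(k)}_1,\dots,\mu^{(k)}_k)$.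
   Context: $\mathcal H(n)$ is the space of Hermitian $n\times n$ matrices, identified with $\mathfrak u(n)^*$ by $\langle B,X\rangle=i\,\mathrm{Tr}(BX)$, $X\in\mathfrak u(n)$. For $X\in\mathcal H(n)$, $\mu^{(k)}_1(X)\ge\dots\ge\mu^{(k)}_k(X)$ are the eigenvalues of the upper-left $k\times k$ block of $X$, in decreasing order. Framed space: let $D=\mathrm{diag}(\lambda_1,\dots,\lambda_n)$. $\mathcal M^{\mathrm{fr}}_{\Lambda_0}$ is the set of triples $(A,F,B)$ with $B\in\mathcal H(n)$, $A$ in the unitary conjugation orbit of $D$, and $F=(v_1,\dots,v_n)$ an ordered orthonormal basis with $Av_i=\lambda_iv_i$. Let $g_F\in U(n)$ be defined by $g_F^\dagger=(v_1,\dots,v_n)$, so $A=g_F^\dagger D g_F$. The symplectic form on $\mathcal M^{\mathrm{fr}}_{\Lambda_0}$ is $d\theta_{\mathcal M}$ with $\theta_{\mathcal M}=i\,\mathrm{Tr}(Bg_F^{-1}dg_F)$; $T^*U(n)\cong U(n)\times\mathfrak u(n)^*$ (left trivialization) carries $d\theta$, $\theta=i\,\mathrm{Tr}(Bg^{-1}dg)$; the map $\Psi(A,F,B)=(g_F,B)$ is a symplectomorphism. Double Gelfand--Zeitlin system: $U(n)\times U(n)$ acts on $T^*U(n)$ by $(h_L,h_R)\cdot(g,B)=(h_Lgh_R^{-1},h_RBh_R^{-1})$ with moment map $\phi(g,B)=(\mathrm{Ad}^*_gB,-B)=(gBg^{-1},-B)$. The double Gelfand--Zeitlin map is $\Phi=(\mu,\mu)\circ\phi$,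 whose components Poisson commute on the strongly regular locus and generate there a Hamiltonian action of $\mathbb T\times\mathbb T$, with $\mathbb T$ the torus of dimension $n(n+1)/2$. The strongly regular locus is where the double Gelfand--Zeitlin map has maximal rank; equivalently, consecutive leading principal blocks satisfy strict interlacing of eigenvalues for both $gBg^{-1}$ and $-B$. $\mathcal M^{\mathrm{fr}}_{\text{s-reg}}$ is its preimage under $\Psi$. $\mathfrak G\subset\mathbb R^{n(n+1)/2}\times\mathbb R^{n(n+1)/2}$ is the Lie algebra $\{((x_1,\dots,x_n,0,\dots,0),(x_n,\dots,x_1,0,\dots,0)):x\in\mathbb R^n\}$ of the subtorus $\mathbb S=\{((t_1,\dots,t_n,1,\dots,1),(t_n,\dots,t_1,1,\dots,1))\}\subset\mathbb T\times\mathbb T$ (coordinates of the top row $k=n$ come first), and $\mathfrak G^\perp$ is its annihilator; the effective torus is $(\mathbb T\times\mathbb T)/\mathbb S$, of dimension $n^2$. The spectral curve degenerating system is the map $\phi_{\mathrm{spec}}$ that collects the residue parameters of all components in the complete caterpillar degeneration of the spectral curve $\det[xI_n-(iu-B/z-A/z^2)]=0$: the $(1,2)$ side of the degeneration gives the eigenvalues $\mu^{(k)}_i(-B)$ and the $(2,1)$ side gives $\mu_i^{(k)}(GBG^{-1})$, $1\le i\le k\le n$, where $G=g_F$ is the frame diagonalizing $A$. *)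

theory Defs
  imports "HOL-Analysis.Analysis" "HOL-Complex_Analysis.Complex_Analysis"
begin

text \<open>Matrices of size \<open>n = CARD('n)\<close> are indexed by a finite linearly ordered type; \<open>ix k\<close> is
  the \<open>k\<close>-th index, \<open>1 \<le> k \<le> n\<close>.\<close>

type_synonym 'n cmat = "complex ^ 'n ^ 'n"

definition ix :: "nat \<Rightarrow> 'n::{finite,linorder}" where
  "ix k = sorted_list_of_set UNIV ! (k - 1)"

definition adj :: "'n::finite cmat \<Rightarrow> 'n cmat" where
  "adj X = (\<chi> i j. cnj (X $ j $ i))"

definition hermitian :: "'n::finite cmat \<Rightarrow> bool" where
  "hermitian X \<longleftrightarrow> adj X = X"

definition unitary :: "'n::finite cmat \<Rightarrow> bool" where
  "unitary g \<longleftrightarrow> adj g ** g = mat 1 \<and> g ** adj g = mat 1"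

definition diag :: "('n::finite \<Rightarrow> real) \<Rightarrow> 'n cmat" where
  "diag d = (\<chi> i j. if i = j then of_real (d i) else 0)"


section \<open>Smooth maps, tangent vectors and forms on subsets of a normed space\<close>

primrec Ck_on :: "nat \<Rightarrow> 'a::real_normed_vector set \<Rightarrow> ('a \<Rightarrow> 'b::real_normed_vector) \<Rightarrow> bool" where
  "Ck_on 0 U f \<longleftrightarrow> continuous_on U f"
| "Ck_on (Suc k) U f \<longleftrightarrow>
     (\<exists>f'. (\<forall>x\<in>U. (f has_derivative f' x) (at x)) \<and> (\<forall>v. Ck_on k U (\<lambda>x. f' x v)))"

text \<open>On an embedded submanifold \<open>S\<close>, a smooth map is one that extends smoothly to a
  neighbourhood of \<open>S\<close>.\<close>

definition smooth_map :: "'a::real_normed_vector set \<Rightarrow> ('a \<Rightarrow> 'b::real_normed_vector) \<Rightarrow> bool" where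
  "smooth_map S f \<longleftrightarrow>
     (\<exists>U h. open U \<and> S \<subseteq> U \<and> (\<forall>k. Ck_on k U h) \<and> (\<forall>x\<in>S. h x = f x))"

definition tangent :: "'a::real_normed_vector set \<Rightarrow> 'a \<Rightarrow> 'a set" where
  "tangent S p = {v. \<exists>c :: real \<Rightarrow> 'a. c 0 = p \<and> (\<forall>\<^sub>F t in nhds 0. c t \<in> S) \<and>
                       (c has_vector_derivative v) (at 0)}"

text \<open>A one-form takes a point and a tangent vector. Its exterior derivative is computed in the
  ambient space with constant vector fields; on vectors tangent to a submanifold this gives the
  exterior derivative of the restricted form.\<close>

definition ext_deriv ::
    "('a::real_normed_vector \<Rightarrow> 'a \<Rightarrow> real) \<Rightarrow> 'a \<Rightarrow> 'a \<Rightarrow> 'a \<Rightarrow> real" where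
  "ext_deriv \<theta> p v w = frechet_derivative (\<lambda>q. \<theta> q w) (at p) v
                     - frechet_derivative (\<lambda>q. \<theta> q v) (at p) w"

definition symplectomorphism ::
    "'a::real_normed_vector set \<Rightarrow> ('a \<Rightarrow> 'a \<Rightarrow> 'a \<Rightarrow> real) \<Rightarrow>
     'b::real_normed_vector set \<Rightarrow> ('b \<Rightarrow> 'b \<Rightarrow> 'b \<Rightarrow> real) \<Rightarrow> ('a \<Rightarrow> 'b) \<Rightarrow> bool" where
  "symplectomorphism S \<omega>S T \<omega>T f \<longleftrightarrow>
     bij_betw f S T \<and> smooth_map S f \<and> smooth_map T (the_inv_into S f) \<and>
     (\<forall>p\<in>S. \<forall>f'. (f has_derivative f') (at p within S) \<longrightarrow>
        (\<forall>v\<in>tangent S p. \<forall>w\<in>tangent S p. \<omega>T (f p) (f' v) (f' w) = \<omega>S p v w))"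


section \<open>Cotangent bundle of the unitary group and the framed space\<close>

text \<open>Left trivialization of the cotangent bundle, with \<open>\<uu>(n)\<^sup>*\<close> identified with the Hermitian
  matrices. The factor \<open>Re\<close> only fixes the type: the trace form is real on tangent vectors.\<close>

definition cotangent_U :: "('n::finite cmat \<times> 'n cmat) set" where
  "cotangent_U = {(g, B). unitary g \<and> hermitian B}"

definition theta_T :: "'n::finite cmat \<times> 'n cmat \<Rightarrow> 'n cmat \<times> 'n cmat \<Rightarrow> real" where
  "theta_T = (\<lambda>(g, B) (dg, dB). Re (\<i> * trace (B ** matrix_inv g ** dg)))"

type_synonym 'n framed_point = "'n cmat \<times> 'n cmat \<times> 'n cmat"

text \<open>In a framed point \<open>(A, F, B)\<close> the vector \<open>v\<^sub>i\<close> of the frame is \<open>F $ i\<close>, i.e. a row of \<open>F\<close>.\<close>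

definition framed_space :: "('n::finite \<Rightarrow> real) \<Rightarrow> 'n framed_point set" where
  "framed_space lam = {(A, F, B).
     hermitian B \<and>
     (\<exists>U. unitary U \<and> A = U ** diag lam ** adj U) \<and>
     (\<forall>i j. (\<Sum>l\<in>UNIV. cnj (F $ i $ l) * F $ j $ l) = (if i = j then 1 else 0)) \<and>
     (\<forall>i. A *v (F $ i) = of_real (lam i) *s (F $ i))}"

text \<open>The columns of \<open>adj (gF F)\<close> are the frame vectors.\<close>

definition gF :: "'n::finite cmat \<Rightarrow> 'n cmat" where
  "gF F = adj (\<chi> i j. F $ j $ i)"

definition theta_M :: "'n::finite framed_point \<Rightarrow> 'n framed_point \<Rightarrow> real" where
  "theta_M = (\<lambda>(A, F, B) (dA, dF, dB).
     Re (\<i> * trace (B ** matrix_inv (gF F) ** frechet_derivative gF (at F) dF)))"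

definition Psi :: "'n::finite framed_point \<Rightarrow> 'n cmat \<times> 'n cmat" where
  "Psi = (\<lambda>(A, F, B). (gF F, B))"


section \<open>The double Gelfand--Zeitlin system\<close>

text \<open>Characteristic polynomial of the upper-left \<open>k \<times> k\<close> block: the determinant of the block is
  that of the matrix in which everything outside the block is replaced by the identity.\<close>

definition block_char_poly :: "nat \<Rightarrow> 'n::{finite,linorder} cmat \<Rightarrow> complex poly" where
  "block_char_poly k X =
     det (\<chi> i j. if i \<le> ix k \<and> j \<le> ix k then (if i = j then [:0, 1:] else 0) - [: X $ i $ j :]
                 else if i = j then 1 else 0)"

text \<open>Vectors of length \<open>n(n+1)/2\<close> are triangular arrays \<open>y k i\<close> with \<open>1 \<le> i \<le> k \<le> n\<close>, extended
  by zero.\<close>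

type_synonym tri = "nat \<Rightarrow> nat \<Rightarrow> real"

definition in_tri :: "nat \<Rightarrow> nat \<Rightarrow> nat \<Rightarrow> bool" where
  "in_tri n k i \<longleftrightarrow> 1 \<le> i \<and> i \<le> k \<and> k \<le> n"

definition tri_space :: "nat \<Rightarrow> tri set" where
  "tri_space n = {y. \<forall>k i. \<not> in_tri n k i \<longrightarrow> y k i = 0}"

definition mu :: "'n::{finite,linorder} cmat \<Rightarrow> tri" where
  "mu X k i = (if in_tri CARD('n) k i
     then rev (sorted_list_of_multiset (image_mset Re (proots (block_char_poly k X)))) ! (i - 1)
     else 0)"

definition strictly_interlacing :: "'n::{finite,linorder} cmat \<Rightarrow> bool" where
  "strictly_interlacing X \<longleftrightarrow>
     (\<forall>k i. 1 \<le> i \<and> i \<le> k \<and> k < CARD('n) \<longrightarrow>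
        mu X (Suc k) i > mu X k i \<and> mu X k i > mu X (Suc k) (Suc i))"

definition coadjoint :: "'n::finite cmat \<Rightarrow> 'n cmat \<Rightarrow> 'n cmat" where
  "coadjoint g B = g ** B ** matrix_inv g"

definition moment_map :: "'n::finite cmat \<times> 'n cmat \<Rightarrow> 'n cmat \<times> 'n cmat" where
  "moment_map = (\<lambda>(g, B). (coadjoint g B, - B))"

definition double_GZ :: "'n::{finite,linorder} cmat \<times> 'n cmat \<Rightarrow> tri \<times> tri" where
  "double_GZ = map_prod mu mu \<circ> moment_map"

definition cotangent_sreg :: "('n::{finite,linorder} cmat \<times> 'n cmat) set" where
  "cotangent_sreg = {p \<in> cotangent_U. strictly_interlacing (fst (moment_map p)) \<and>
                                      strictly_interlacing (snd (moment_map p))}"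

definition framed_sreg :: "('n::{finite,linorder} \<Rightarrow> real) \<Rightarrow> 'n framed_point set" where
  "framed_sreg lam = {p \<in> framed_space lam. Psi p \<in> cotangent_sreg}"

definition top_row :: "nat \<Rightarrow> (nat \<Rightarrow> real) \<Rightarrow> tri" where
  "top_row n x k i = (if k = n \<and> in_tri n k i then x i else 0)"

definition Lie_G :: "nat \<Rightarrow> (tri \<times> tri) set" where
  "Lie_G n = {(top_row n x, top_row n (\<lambda>i. x (n + 1 - i))) | x. True}"

definition Lie_G_perp :: "nat \<Rightarrow> (tri \<times> tri) set" where
  "Lie_G_perp n = {(a, b). a \<in> tri_space n \<and> b \<in> tri_space n \<and>
     (\<forall>(x, y) \<in> Lie_G n. (\<Sum>k=1..n. \<Sum>i=1..k. a k i * x k i + b k i * y k i) = 0)}"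


section \<open>Caterpillar degeneration of the spectral curve\<close>

text \<open>The curve \<open>det (x I - (i u - B/z - A/z\<^sup>2)) = 0\<close>, carrying the one-form \<open>x dz\<close>.\<close>

definition spectral_curve ::
    "('n::finite \<Rightarrow> real) \<Rightarrow> 'n cmat \<Rightarrow> 'n cmat \<Rightarrow> (complex \<times> complex) set" where
  "spectral_curve u A B = {(z, x). z \<noteq> 0 \<and>
     det (\<chi> i j. mat x $ i $ j
        - (\<i> * diag u $ i $ j - B $ i $ j / z - A $ i $ j / z ^ 2)) = 0}"

text \<open>The degeneration moves \<open>u\<close> and the eigenvalues of \<open>A\<close>, which start at \<open>lam\<close>, while
  \<open>B\<close> and the eigenframe of \<open>A\<close> stay fixed. The condition on \<open>u j * La l\<close> separates the two
  irregular points, so that the curve breaks into a part with poles of order 1 at \<open>z = 0\<close> and 2 at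
  infinity (the (1,2) side) and one with poles of order 2 at \<open>z = 0\<close> and 1 at infinity (the (2,1)
  side); the quotient conditions are the limit \<open>u\<^sub>1 \<lless> u\<^sub>2 \<lless> \<dots>\<close> to the caterpillar point,
  on either side.\<close>

definition caterpillar_family ::
    "('n::{finite,linorder} \<Rightarrow> real) \<Rightarrow> (nat \<Rightarrow> 'n \<Rightarrow> real) \<Rightarrow> (nat \<Rightarrow> 'n \<Rightarrow> real) \<Rightarrow> bool" where
  "caterpillar_family lam u La \<longleftrightarrow>
     La 0 = lam \<and>
     (\<forall>m. inj (u m) \<and> inj (La m)) \<and>
     (\<forall>j. \<forall>\<^sub>F m in sequentially. u m j \<noteq> 0 \<and> La m j \<noteq> 0) \<and>
     (\<forall>j l. j < l \<longrightarrow> (\<lambda>m. u m j / u m l) \<longlonglongrightarrow> 0 \<and> (\<lambda>m. La m j / La m l) \<longlonglongrightarrow> 0) \<and>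
     (\<forall>j l. (\<lambda>m. u m j * La m l) \<longlonglongrightarrow> 0)"

definition spectral_family ::
    "(nat \<Rightarrow> 'n::finite \<Rightarrow> real) \<Rightarrow> (nat \<Rightarrow> 'n \<Rightarrow> real) \<Rightarrow> 'n framed_point \<Rightarrow>
     nat \<Rightarrow> (complex \<times> complex) set" where
  "spectral_family u La = (\<lambda>(A, F, B) m.
     spectral_curve (u m) (adj (gF F) ** diag (La m) ** gF F) B)"

text \<open>The curve seen at scale \<open>s\<close>: the substitution \<open>z = s \<zeta>\<close>, \<open>x = y / s\<close> preserves
  \<open>x dz\<close>.\<close>

definition rescale :: "real \<Rightarrow> (complex \<times> complex) set \<Rightarrow> (complex \<times> complex) set" where
  "rescale s C = {(\<zeta>, y). (of_real s * \<zeta>, y / of_real s) \<in> C}"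

text \<open>Fibrewise limit over \<open>\<zeta> \<noteq> 0\<close>; branches that escape to infinity are lost, so the limit has
  fewer sheets.\<close>

definition limit_curve :: "(nat \<Rightarrow> (complex \<times> complex) set) \<Rightarrow> (complex \<times> complex) set" where
  "limit_curve C = {(\<zeta>, y). \<zeta> \<noteq> 0 \<and>
     (\<exists>f. (\<forall>\<^sub>F m in sequentially. (\<zeta>, f m) \<in> C m) \<and> f \<longlonglongrightarrow> y)}"

text \<open>The components of the degenerate curve: the \<open>k\<close>-th one lives at scale \<open>1 / u\<^sub>k\<close> on the (1,2)
  side and at scale \<open>\<lambda>\<^sub>k\<close> on the (2,1) side.\<close>

definition component12 ::
    "(nat \<Rightarrow> 'n::{finite,linorder} \<Rightarrow> real) \<Rightarrow> (nat \<Rightarrow> 'n \<Rightarrow> real) \<Rightarrow> 'n framed_point \<Rightarrow> nat \<Rightarrow>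
     (complex \<times> complex) set" where
  "component12 u La p k = limit_curve (\<lambda>m. rescale (1 / u m (ix k)) (spectral_family u La p m))"

definition component21 ::
    "(nat \<Rightarrow> 'n::{finite,linorder} \<Rightarrow> real) \<Rightarrow> (nat \<Rightarrow> 'n \<Rightarrow> real) \<Rightarrow> 'n framed_point \<Rightarrow> nat \<Rightarrow>
     (complex \<times> complex) set" where
  "component21 u La p k = limit_curve (\<lambda>m. rescale (La m (ix k)) (spectral_family u La p m))"

text \<open>Residues of \<open>x dz\<close> on the local sheets of a curve over \<open>z = 0\<close> and over \<open>z = \<infinity>\<close>; at
  infinity \<open>x(z) dz = - x(1/w) / w\<^sup>2 dw\<close> with \<open>w = 1/z\<close>. These are the simple poles of the
  (1,2) and (2,1) components, respectively.\<close>

definition residues_at_0 :: "(complex \<times> complex) set \<Rightarrow> complex set" where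
  "residues_at_0 C = {residue x 0 | x.
     \<exists>\<epsilon>>0. x holomorphic_on (ball 0 \<epsilon> - {0}) \<and> (\<forall>z\<in>ball 0 \<epsilon> - {0}. (z, x z) \<in> C)}"

definition residues_at_infinity :: "(complex \<times> complex) set \<Rightarrow> complex set" where
  "residues_at_infinity C = {residue (\<lambda>w. - x (1 / w) / w ^ 2) 0 | x.
     \<exists>R>0. x holomorphic_on {z. norm z > R} \<and> (\<forall>z. norm z > R \<longrightarrow> (z, x z) \<in> C)}"

text \<open>The residues of the \<open>k\<close>-th component in decreasing order. On the strongly regular locus
  there are \<open>k\<close> distinct ones, all real.\<close>

definition ordered_residues :: "nat \<Rightarrow> (nat \<Rightarrow> complex set) \<Rightarrow> tri" where
  "ordered_residues n R k i =
     (if in_tri n k i then rev (sorted_list_of_set (Re ` R k)) ! (i - 1) else 0)"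

definition phi_spec ::
    "(nat \<Rightarrow> 'n::{finite,linorder} \<Rightarrow> real) \<Rightarrow> (nat \<Rightarrow> 'n \<Rightarrow> real) \<Rightarrow> 'n framed_point \<Rightarrow>
     tri \<times> tri" where
  "phi_spec u La p =
     (ordered_residues CARD('n) (\<lambda>k. residues_at_infinity (component21 u La p k)),
      ordered_residues CARD('n) (\<lambda>k. residues_at_0 (component12 u La p k)))"

end

theory Submission
  imports Defs "HOL-Computational_Algebra.Fundamental_Theorem_Algebra"
begin

text \<open>Seen at scale \<open>1 / u\<^sub>k\<close>, the spectral matrix has diagonal entries that blow up exactly in the
  rows beyond \<open>k\<close>. Dividing those rows by their diagonal entries gives a convergent determinant,
  whose limit is the determinant of the leading \<open>k \<times> k\<close> block. That block depends on the remaining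
  scale only through its last diagonal entry, so with \<open>w = z y\<close> the limit curve is
  \<open>P w = c z Q w\<close>, where \<open>P\<close> and \<open>Q\<close> are the characteristic polynomials of the leading blocks of
  sizes \<open>k\<close> and \<open>k - 1\<close>. By Hurwitz's theorem it is also the fibrewise limit of the curves. Its
  branches over \<open>z = 0\<close> are bounded functions \<open>w\<close> of \<open>z\<close>, hence extend holomorphically, and the
  residue of \<open>y dz = (w / z) dz\<close> is the root \<open>w(0)\<close> of \<open>P\<close>; strict interlacing makes the roots
  simple, so each of them carries a branch. Conjugating the spectral matrix by the frame turns the other
  side of the degeneration into the same situation, with \<open>1 / z\<close> in place of \<open>z\<close>.\<close>

no_notation fps_nth (infixl "$" 75)

section \<open>Determinants of principal blocks\<close>

text \<open>A principal minor, padded by the identity so that minors of all sizes live in one matrix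
  type. Arbitrary index sets are allowed because removing a single index must stay within the
  notion.\<close>

definition block_det :: "'n::finite set \<Rightarrow> 'a::comm_ring_1 ^ 'n ^ 'n \<Rightarrow> 'a" where
  "block_det S M = det (\<chi> i j. if i \<in> S \<and> j \<in> S then M $ i $ j else if i = j then 1 else 0)"

definition block_poly :: "'n::finite set \<Rightarrow> 'a::comm_ring_1 ^ 'n ^ 'n \<Rightarrow> 'a poly" where
  "block_poly S X = block_det S (\<chi> i j. (if i = j then [:0, 1:] else 0) - [:X $ i $ j:])"

lemma block_det_UNIV: "block_det UNIV M = det M"
  by (simp add: block_det_def)

text \<open>In the Leibniz expansion a permutation that moves an index outside \<open>S\<close>
  meets a zero entry in that row. The others map \<open>S\<close> to itself, so the entries of
  \<open>M\<close> in rows of \<open>S\<close> and columns outside \<open>S\<close> never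
  occur.\<close>

lemma det_outside_scalar:
  fixes M :: "'a::comm_ring_1 ^ 'n::finite ^ 'n"
  assumes "\<And>i j. i \<notin> S \<Longrightarrow> M $ i $ j = (if i = j then c i else 0)"
  shows "det M = (\<Prod>i\<in>-S. c i) * block_det S M"
proof -
  let ?N = "\<chi> i j. if i \<in> S \<and> j \<in> S then M $ i $ j else if i = j then 1 else 0"
  have "(\<Prod>i\<in>UNIV. M $ i $ p i) = (\<Prod>i\<in>-S. c i) * (\<Prod>i\<in>UNIV. ?N $ i $ p i)"
    if p: "p permutes UNIV" for p
  proof (cases "\<forall>i. i \<notin> S \<longrightarrow> p i = i")
    case True
    have pS: "p i \<in> S" if "i \<in> S" for i
      using True p that by (metis permutes_inverses(2))
    have split: "(\<Prod>i\<in>UNIV. f i) = (\<Prod>i\<in>-S. f i) * (\<Prod>i\<in>S. f i)" for f :: "'n \<Rightarrow> 'a"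
      using prod.union_disjoint[of "-S" S f] by auto
    show ?thesis
      by (subst (1 2) split) (simp add: True assms pS)
  next
    case False
    then obtain i where i: "i \<notin> S" "p i \<noteq> i"
      by blast
    then have "M $ i $ p i = 0" "?N $ i $ p i = 0"
      using assms by auto
    then show ?thesis
      by (metis (no_types, lifting) UNIV_I finite mult_zero_right prod_zero)
  qed
  then show ?thesis
    unfolding det_def block_det_def
    by (simp add: sum_distrib_left mult.left_commute)
qed

text \<open>Linearity of the determinant in row \<open>s\<close>: the added row is \<open>t\<close>
  times a unit vector, and expanding along it leaves the minor without \<open>s\<close>.\<close>

lemma block_det_add_diag:
  fixes M :: "'a::comm_ring_1 ^ 'n::finite ^ 'n"
  assumes "s \<in> S"
  shows "block_det S (\<chi> i j. M $ i $ j + (if i = s \<and> j = s then t else 0))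
    = block_det S M + t * block_det (S - {s}) M"
proof -
  let ?c = "\<lambda>i. \<chi> j. if i \<in> S \<and> j \<in> S then M $ i $ j else if i = j then 1 else 0"
  let ?b = "\<lambda>i. (\<chi> j. if j = s then t else 0) :: 'a ^ 'n"
  have "block_det S (\<chi> i j. M $ i $ j + (if i = s \<and> j = s then t else 0))
    = det (\<chi> i. if i = s then ?c i + ?b i else ?c i)"
    unfolding block_det_def using assms by (intro arg_cong[where f = det]) (auto simp: vec_eq_iff)
  also have "\<dots> = det (\<chi> i. if i = s then ?c i else ?c i) + det (\<chi> i. if i = s then ?b i else ?c i)"
    by (rule det_row_add)
  also have "det (\<chi> i. if i = s then ?c i else ?c i) = block_det S M"
    by (simp add: block_det_def)
  also have "det (\<chi> i. if i = s then ?b i else ?c i) = 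
     (\<Prod>i\<in>-(S - {s}). if i = s then t else 1) * block_det (S - {s}) (\<chi> i. if i = s then ?b i else ?c i)"
    by (rule det_outside_scalar) auto
  also have "(\<Prod>i\<in>-(S - {s}). if i = s then t else 1) = t"
    by (simp add: prod.delta)
  also have "block_det (S - {s}) (\<chi> i. if i = s then ?b i else ?c i) = block_det (S - {s}) M"
    unfolding block_det_def by (intro arg_cong[where f = det]) (auto simp: vec_eq_iff)
  finally show ?thesis .
qed

lemma poly_det: "poly (det M) x = det (\<chi> i j. poly (M $ i $ j) x)"
  by (simp add: det_def poly_sum poly_prod of_int_poly)

lemma poly_block_poly:
  "poly (block_poly S X) x = block_det S (\<chi> i j. (if i = j then x else 0) - X $ i $ j)"
  unfolding block_poly_def block_det_def poly_det
  by (intro arg_cong[where f = det]) (auto simp: vec_eq_iff)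

text \<open>The identity permutation contributes a product of monic linear factors over
  \<open>S\<close>. Every other permutation either meets a zero entry or loses a linear factor, so
  it does not reach degree \<open>card S\<close>.\<close>

lemma block_poly_monic:
  fixes X :: "'a::idom ^ 'n::finite ^ 'n"
  shows degree_block_poly: "degree (block_poly S X) = card S"
    and lead_coeff_block_poly: "lead_coeff (block_poly S X) = 1"
proof -
  let ?N = "(\<chi> i j. if i \<in> S \<and> j \<in> S then (if i = j then [:0, 1:] else 0) - [:X $ i $ j:]
    else if i = j then 1 else 0) :: 'a poly ^ 'n ^ 'n"
  let ?t = "\<lambda>p. of_int (sign p) * (\<Prod>i\<in>UNIV. ?N $ i $ p i)"
  have eq: "block_poly S X = (\<Sum>p | p permutes UNIV. ?t p)"
    by (simp add: block_poly_def block_det_def det_def if_distrib cong: if_cong)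
  have t_id: "?t id = (\<Prod>i\<in>S. [:- X $ i $ i, 1:])"
  proof -
    have "?t id = (\<Prod>i\<in>UNIV. if i \<in> S then [:- X $ i $ i, 1:] else 1)"
      by (auto intro!: prod.cong)
    then show ?thesis
      by (simp add: prod.If_cases)
  qed
  have deg_id: "degree (?t id) = card S"
    unfolding t_id by (subst degree_prod_sum_eq) auto
  have lc_id: "lead_coeff (?t id) = 1"
    unfolding t_id by (simp add: lead_coeff_prod)
  have other: "coeff (?t p) k = 0" if p: "p permutes UNIV" "p \<noteq> id" and k: "k \<ge> card S" for p k
  proof (cases "\<forall>i. i \<notin> S \<longrightarrow> p i = i")
    case True
    obtain s where s: "p s \<noteq> s"
      using p(2) by (auto simp: fun_eq_iff)
    with True have "s \<in> S" by blast
    have "degree (?t p) \<le> degree (\<Prod>i\<in>UNIV. ?N $ i $ p i)"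
      by (rule order_trans[OF degree_mult_le]) (simp add: of_int_poly)
    also have "\<dots> \<le> (\<Sum>i\<in>UNIV. degree (?N $ i $ p i))"
      using degree_prod_sum_le[of UNIV "\<lambda>i. ?N $ i $ p i"] by (simp add: o_def)
    \<comment> \<open>Off-diagonal entries are constants, so the moved index \<open>s\<close>
      contributes degree 0.\<close>
    also have "\<dots> \<le> (\<Sum>i\<in>UNIV. if i \<in> S - {s} then 1 else 0)"
      using s by (intro sum_mono) auto
    also have "\<dots> = card (S - {s})"
      by (simp add: sum.If_cases set_diff_eq)
    also have "\<dots> < card S"
      using \<open>s \<in> S\<close> by (intro psubset_card_mono) auto
    finally show ?thesis
      using k by (intro coeff_eq_0) auto
  next
    case False
    then obtain i where i: "i \<notin> S" "p i \<noteq> i"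
      by blast
    then have "?N $ i $ p i = 0"
      by auto
    then have "(\<Prod>i\<in>UNIV. ?N $ i $ p i) = 0"
      by (intro prod_zero bexI[of _ i]) auto
    then show ?thesis
      by (simp only: mult_zero_right coeff_0)
  qed
  have c: "coeff (block_poly S X) k = coeff (?t id) k" if "k \<ge> card S" for k
  proof -
    have "coeff (block_poly S X) k = (\<Sum>p | p permutes UNIV. coeff (?t p) k)"
      unfolding eq by (rule coeff_sum)
    also have "\<dots> = (\<Sum>p\<in>{id}. coeff (?t p) k)"
      by (rule sum.mono_neutral_right) (use other that in \<open>auto simp: permutes_id\<close>)
    finally show ?thesis by simp
  qed
  have "coeff (block_poly S X) (card S) = 1"
    using c[of "card S"] lc_id deg_id by simp
  moreover have "degree (block_poly S X) \<le> card S"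
    by (rule degree_le) (use c deg_id in \<open>auto simp: coeff_eq_0\<close>)
  ultimately show "degree (block_poly S X) = card S"
    by (metis le_antisym le_degree zero_neq_one)
  with \<open>coeff (block_poly S X) (card S) = 1\<close> show "lead_coeff (block_poly S X) = 1"
    by simp
qed

lemma block_poly_nonzero: "block_poly S (X :: 'a::idom ^ 'n::finite ^ 'n) \<noteq> 0"
  using lead_coeff_block_poly[of S X] by force

lemma det_scale:
  fixes M :: "'a::comm_ring_1 ^ 'n::finite ^ 'n"
  shows "det (\<chi> i j. c * M $ i $ j) = c ^ CARD('n) * det M"
proof -
  have "(\<chi> i j. c * M $ i $ j) = (\<chi> i. c *s (M $ i))"
    by (simp add: vec_eq_iff)
  then show ?thesis
    by (simp add: det_rows_mul)
qed

section \<open>Limits of zeros\<close>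

text \<open>A convergent sequence together with its limit is compact, so joint continuity becomes
  uniform continuity on the product with \<open>K\<close>.\<close>

lemma uniform_limit_continuous_parameter:
  fixes \<Phi> :: "'a::metric_space \<Rightarrow> 'b::heine_borel \<Rightarrow> 'c::metric_space"
  assumes K: "compact K" and cont: "continuous_on UNIV (\<lambda>(y, a). \<Phi> y a)" and lim: "a \<longlonglongrightarrow> a'"
  shows "uniform_limit K (\<lambda>m y. \<Phi> y (a m)) (\<lambda>y. \<Phi> y a') sequentially"
proof (rule uniform_limitI)
  fix e :: real
  assume "e > 0"
  let ?C = "K \<times> insert a' (range a)"
  have "compact ?C"
    using K compact_sequence_with_limit[OF lim] by (rule compact_Times)
  then have "uniformly_continuous_on ?C (\<lambda>(y, a). \<Phi> y a)"
    by (intro compact_uniformly_continuous continuous_on_subset[OF cont]) auto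
  from this[unfolded uniformly_continuous_on_def, rule_format, OF \<open>e > 0\<close>]
  obtain d where "d > 0"
    and d: "\<forall>p\<in>?C. \<forall>q\<in>?C. dist q p < d \<longrightarrow>
      dist (case q of (y, a) \<Rightarrow> \<Phi> y a) (case p of (y, a) \<Rightarrow> \<Phi> y a) < e"
    by (elim exE conjE)
  have "\<forall>\<^sub>F m in sequentially. dist (a m) a' < d"
    using lim \<open>d > 0\<close> by (rule tendstoD)
  then show "\<forall>\<^sub>F m in sequentially. \<forall>y\<in>K. dist (\<Phi> y (a m)) (\<Phi> y a') < e"
  proof eventually_elim
    case (elim m)
    show ?case
    proof
      fix y
      assume "y \<in> K"
      then show "dist (\<Phi> y (a m)) (\<Phi> y a') < e"
        using d[rule_format, of "(y, a')" "(y, a m)"] elim by (simp add: dist_Pair_Pair)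
    qed
  qed
qed

lemma continuous_on_det [continuous_intros]:
  fixes f :: "'a::topological_space \<Rightarrow> 'b::{real_normed_field} ^ 'n::finite ^ 'n"
  assumes "\<And>i j. continuous_on S (\<lambda>x. f x $ i $ j)"
  shows "continuous_on S (\<lambda>x. det (f x))"
  unfolding det_def by (intro continuous_intros assms)

text \<open>Otherwise a subsequence has no zeros in the ball. By Hurwitz its limit is then zero-free
  or constant there, whereas a nonzero polynomial with a root at the centre is neither.\<close>

lemma zeros_near_limit_zero:
  fixes F :: "nat \<Rightarrow> complex \<Rightarrow> complex" and p :: "complex poly"
  assumes hol: "\<And>m. F m holomorphic_on UNIV"
    and lim: "\<And>K. compact K \<Longrightarrow> uniform_limit K F (poly p) sequentially"
    and p: "p \<noteq> 0" "poly p y = 0" and "\<epsilon> > 0"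
  shows "\<forall>\<^sub>F m in sequentially. \<exists>w\<in>ball y \<epsilon>. F m w = 0"
proof (rule ccontr)
  assume "\<not> ?thesis"
  then have "infinite {m. \<forall>w\<in>ball y \<epsilon>. F m w \<noteq> 0}"
    unfolding not_eventually cofinite_eq_sequentially[symmetric] frequently_cofinite by simp
  from infinite_enumerate[OF this] obtain r :: "nat \<Rightarrow> nat"
    where r: "strict_mono r" "\<forall>m. r m \<in> {m. \<forall>w\<in>ball y \<epsilon>. F m w \<noteq> 0}"
    by (elim exE conjE)
  have "\<not> poly p constant_on ball y \<epsilon>"
  proof
    assume "poly p constant_on ball y \<epsilon>"
    then have "ball y \<epsilon> \<subseteq> {x. poly p x = 0}"
      using p(2) \<open>\<epsilon> > 0\<close> unfolding constant_on_def by auto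
    then have "finite (ball y \<epsilon>)"
      using poly_roots_finite[OF p(1)] finite_subset by blast
    then show False
      using \<open>\<epsilon> > 0\<close> finite_imp_not_open[of "ball y \<epsilon>"] by simp
  qed
  then have "poly p y \<noteq> 0"
  proof (rule Hurwitz_no_zeros[of "ball y \<epsilon>" "\<lambda>m. F (r m)" "poly p", rotated 5])
    show "F (r n) z \<noteq> 0" if "z \<in> ball y \<epsilon>" for n z
      using r(2) that by blast
    show "F (r n) holomorphic_on ball y \<epsilon>" for n
      using hol holomorphic_on_subset by blast
    show "uniform_limit K (\<lambda>m. F (r m)) (poly p) sequentially" if "compact K" for K
      using filterlim_compose[OF lim[OF that] filterlim_subseq[OF r(1)]] .
  qed (use \<open>\<epsilon> > 0\<close> in \<open>auto intro: holomorphic_intros\<close>)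
  with p show False by simp
qed

text \<open>Uniform convergence near \<open>y\<close> carries convergent zeros to a zero of the
  limit; Hurwitz's theorem gives the converse.\<close>

lemma converging_zeros_iff:
  fixes F :: "nat \<Rightarrow> complex \<Rightarrow> complex" and p :: "complex poly"
  assumes hol: "\<And>m. F m holomorphic_on UNIV"
    and lim: "\<And>K. compact K \<Longrightarrow> uniform_limit K F (poly p) sequentially"
    and "p \<noteq> 0"
  shows "(\<exists>f. (\<forall>\<^sub>F m in sequentially. F m (f m) = 0) \<and> f \<longlonglongrightarrow> y) \<longleftrightarrow> poly p y = 0"
proof
  assume "\<exists>f. (\<forall>\<^sub>F m in sequentially. F m (f m) = 0) \<and> f \<longlonglongrightarrow> y"
  then obtain f where f: "\<forall>\<^sub>F m in sequentially. F m (f m) = 0" "f \<longlonglongrightarrow> y"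
    by blast
  have ev: "\<forall>\<^sub>F m in sequentially. f m \<in> cball y 1"
    using tendstoD[OF f(2), of 1] by (auto elim: eventually_mono simp: dist_commute)
  have "uniform_limit (cball y 1) F (poly p) sequentially"
    by (intro lim) auto
  then have "(\<lambda>m. dist (F m (f m)) (poly p (f m))) \<longlonglongrightarrow> 0"
    using ev unfolding uniform_limit_iff tendsto_iff
    by (auto elim: eventually_elim2)
  moreover have "(\<lambda>m. poly p (f m)) \<longlonglongrightarrow> poly p y"
    by (intro tendsto_intros f)
  ultimately have "(\<lambda>m. F m (f m)) \<longlonglongrightarrow> poly p y"
    using Lim_transform[of "\<lambda>m. poly p (f m)" "poly p y" sequentially "\<lambda>m. F m (f m)"]
    by (simp add: dist_norm tendsto_norm_zero_iff)
  then show "poly p y = 0"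
    using f(1) tendsto_unique tendsto_eventually by (metis trivial_limit_sequentially)
next
  assume y: "poly p y = 0"
  \<comment> \<open>Taking the nearest zero gives one sequence that serves every \<epsilon> at once.
    The zero set is nonempty for all large \<open>m\<close>; the arbitrary values before that do not
    affect the limit.\<close>
  define f where "f m = closest_point {w. F m w = 0} y" for m
  have closed: "closed {w. F m w = 0}" for m
    using holomorphic_on_imp_continuous_on[OF hol] by (intro closed_Collect_eq continuous_on_const) auto
  have near: "\<forall>\<^sub>F m in sequentially. F m (f m) = 0 \<and> dist (f m) y < \<epsilon>" if "\<epsilon> > 0" for \<epsilon>
  proof -
    have "\<forall>\<^sub>F m in sequentially. \<exists>w\<in>ball y \<epsilon>. F m w = 0"
      by (rule zeros_near_limit_zero[OF hol _ \<open>p \<noteq> 0\<close> y that]) (rule lim)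
    then show ?thesis
    proof eventually_elim
      case (elim m)
      then obtain w where w: "dist y w < \<epsilon>" "F m w = 0" by auto
      then have ne: "{w. F m w = 0} \<noteq> {}" by auto
      show ?case
        using closest_point_in_set[OF closed ne, of y] closest_point_le[OF closed[of m], of w y] w
        by (auto simp: f_def dist_commute)
    qed
  qed
  have "f \<longlonglongrightarrow> y"
    using near by (auto intro!: tendstoI simp: eventually_conj_iff)
  moreover have "\<forall>\<^sub>F m in sequentially. F m (f m) = 0"
    using near[of 1] by (simp add: eventually_conj_iff)
  ultimately show "\<exists>f. (\<forall>\<^sub>F m in sequentially. F m (f m) = 0) \<and> f \<longlonglongrightarrow> y"
    by blast
qed

text \<open>Multiplying row \<open>i\<close> by \<open>r m i\<close> keeps the zeros for large
  \<open>m\<close> and turns the rows beyond \<open>k\<close> into rows of the identity in the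
  limit. What survives is the block \<open>{..k}\<close> with \<open>c\<close> added to its last
  diagonal entry, which \<open>block_det_add_diag\<close> expands.\<close>

lemma converging_det_zeros_iff:
  fixes X :: "'n::{finite,linorder} cmat"
  assumes below: "\<And>i. i < k \<Longrightarrow> (\<lambda>m. d m i) \<longlonglongrightarrow> 0"
    and at: "(\<lambda>m. d m k) \<longlonglongrightarrow> c"
    and above: "\<And>i. k < i \<Longrightarrow> (\<lambda>m. inverse (d m i)) \<longlonglongrightarrow> 0" "\<And>i. k < i \<Longrightarrow> \<forall>\<^sub>F m in sequentially. d m i \<noteq> 0"
    and R: "\<And>i j. (\<lambda>m. R m i j) \<longlonglongrightarrow> 0"
  shows "(\<exists>f. (\<forall>\<^sub>F m in sequentially.
      det (\<chi> i j. (if i = j then f m + d m i else 0) - X $ i $ j + R m i j) = 0) \<and> f \<longlonglongrightarrow> y)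
    \<longleftrightarrow> poly (block_poly {..k} X) y + c * poly (block_poly {..<k} X) y = 0"
proof -
  let ?p = "block_poly {..k} X + smult c (block_poly {..<k} X)"
  define r where "r m i = (if i \<le> k then 1 else inverse (d m i))" for m i
  \<comment> \<open>The scaled matrix is affine in \<open>y\<close>, namely \<alpha> times
    \<open>y\<close> plus \<beta>. Treating the pair of coefficient matrices as a convergent
    parameter yields locally uniform convergence of the determinants.\<close>
  define \<alpha> :: "nat \<Rightarrow> 'n cmat" where "\<alpha> m = (\<chi> i j. if i = j then r m i else 0)" for m
  define \<beta> :: "nat \<Rightarrow> 'n cmat" where
    "\<beta> m = (\<chi> i j. (if i = j then if i \<le> k then d m i else 1 else 0) + r m i * (R m i j - X $ i $ j))" for m
  define \<alpha>' :: "'n cmat" where "\<alpha>' = (\<chi> i j. if i = j \<and> i \<le> k then 1 else 0)"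
  define \<beta>' :: "'n cmat" where
    "\<beta>' = (\<chi> i j. if i \<le> k then (if i = j \<and> i = k then c else 0) - X $ i $ j
       else if i = j then 1 else 0)"
  define \<Phi> :: "complex \<Rightarrow> 'n cmat \<times> 'n cmat \<Rightarrow> complex" where
    "\<Phi> y a = det (\<chi> i j. fst a $ i $ j * y + snd a $ i $ j)" for y a
  have r: "(\<lambda>m. r m i) \<longlonglongrightarrow> (if i \<le> k then 1 else 0)" for i
    using above(1)[of i] by (auto simp: r_def)
  have "\<alpha> \<longlonglongrightarrow> \<alpha>'"
    unfolding \<alpha>_def \<alpha>'_def
  proof (intro tendsto_vec_lambda)
    show "(\<lambda>m. if i = j then r m i else 0) \<longlonglongrightarrow> (if i = j \<and> i \<le> k then 1 else 0)" for i j
      using r[of i] by (cases "i = j"; cases "i \<le> k") auto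
  qed
  moreover have "\<beta> \<longlonglongrightarrow> \<beta>'"
    unfolding \<beta>_def \<beta>'_def
  proof (intro tendsto_vec_lambda)
    fix i j
    have "(\<lambda>m. if i = j then if i \<le> k then d m i else 1 else 0) \<longlonglongrightarrow> 
      (if i = j then if i \<le> k then if i = k then c else 0 else 1 else 0)"
      using below[of i] at by auto
    moreover have "(\<lambda>m. r m i * (R m i j - X $ i $ j)) \<longlonglongrightarrow> (if i \<le> k then 1 else 0) * (0 - X $ i $ j)"
      by (intro tendsto_intros r R)
    ultimately have "(\<lambda>m. (if i = j then if i \<le> k then d m i else 1 else 0) + r m i * (R m i j - X $ i $ j)) \<longlonglongrightarrow> 
      (if i = j then if i \<le> k then if i = k then c else 0 else 1 else 0) + (if i \<le> k then 1 else 0) * (0 - X $ i $ j)"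
      by (rule tendsto_add)
    then show "(\<lambda>m. (if i = j then if i \<le> k then d m i else 1 else 0) + r m i * (R m i j - X $ i $ j)) \<longlonglongrightarrow> 
      (if i \<le> k then (if i = j \<and> i = k then c else 0) - X $ i $ j else if i = j then 1 else 0)"
      by (auto split: if_splits)
  qed
  ultimately have lim: "(\<lambda>m. (\<alpha> m, \<beta> m)) \<longlonglongrightarrow> (\<alpha>', \<beta>')"
    by (rule tendsto_Pair)
  have \<Phi>_cont: "continuous_on UNIV (\<lambda>(y, a). \<Phi> y a)"
    unfolding \<Phi>_def case_prod_beta by (auto intro!: continuous_intros)
  have \<Phi>_lim: "\<Phi> y (\<alpha>', \<beta>') = poly ?p y" for y
  proof -
    let ?M = "\<chi> i j. (if i = j then y else 0) - X $ i $ j"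
    have "\<Phi> y (\<alpha>', \<beta>') = block_det {..k} (\<chi> i j. \<alpha>' $ i $ j * y + \<beta>' $ i $ j)"
      unfolding \<Phi>_def by (subst det_outside_scalar[where S = "{..k}" and c = "\<lambda>_. 1"]) (auto simp: \<alpha>'_def \<beta>'_def)
    also have "\<dots> = block_det {..k} (\<chi> i j. ?M $ i $ j + (if i = k \<and> j = k then c else 0))"
      unfolding block_det_def by (intro arg_cong[where f = det]) (auto simp: vec_eq_iff \<alpha>'_def \<beta>'_def)
    also have "\<dots> = block_det {..k} ?M + c * block_det ({..k} - {k}) ?M"
      by (rule block_det_add_diag) simp
    also have "{..k} - {k} = {..<k}"
      by auto
    finally show ?thesis
      by (simp add: poly_block_poly)
  qed
  \<comment> \<open>The term with \<open>c\<close> has smaller degree, so the sum keeps the leading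
    coefficient 1 of the larger block.\<close>
  have p: "?p \<noteq> 0"
  proof -
    have "card {..<k} < card {..k}"
      by (rule psubset_card_mono) auto
    then have "coeff ?p (card {..k}) = 1"
      using lead_coeff_block_poly[of "{..k}" X] by (simp add: degree_block_poly coeff_eq_0)
    then show ?thesis by force
  qed
  have "\<forall>\<^sub>F m in sequentially. \<forall>i. k < i \<longrightarrow> d m i \<noteq> 0"
    using above(2) by (intro eventually_all_finite) (auto simp: eventually_mono)
  then have ev: "\<forall>\<^sub>F m in sequentially. \<forall>y.
     \<Phi> y (\<alpha> m, \<beta> m) = 0 \<longleftrightarrow> det (\<chi> i j. (if i = j then y + d m i else 0) - X $ i $ j + R m i j) = 0"
  proof eventually_elim
    case (elim m)
    have r0: "r m i \<noteq> 0" for i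
      using elim by (auto simp: r_def)
    show ?case
    proof
      fix y
      let ?N = "\<chi> i j. (if i = j then y + d m i else 0) - X $ i $ j + R m i j"
      have "\<Phi> y (\<alpha> m, \<beta> m) = det (\<chi> i. r m i *s (?N $ i))"
        unfolding \<Phi>_def using elim
        by (intro arg_cong[where f = det]) (auto simp: vec_eq_iff \<alpha>_def \<beta>_def r_def algebra_simps)
      also have "\<dots> = (\<Prod>i\<in>UNIV. r m i) * det ?N"
        by (simp add: det_rows_mul)
      finally show "\<Phi> y (\<alpha> m, \<beta> m) = 0 \<longleftrightarrow> det ?N = 0"
        using r0 by simp
    qed
  qed
  have "(\<exists>f. (\<forall>\<^sub>F m in sequentially. \<Phi> (f m) (\<alpha> m, \<beta> m) = 0) \<and> f \<longlonglongrightarrow> y) \<longleftrightarrow> poly ?p y = 0"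
  proof (rule converging_zeros_iff[OF _ _ p])
    show "(\<lambda>y. \<Phi> y (\<alpha> m, \<beta> m)) holomorphic_on UNIV" for m
      unfolding \<Phi>_def det_def by (simp, intro holomorphic_intros)
    show "uniform_limit K (\<lambda>m y. \<Phi> y (\<alpha> m, \<beta> m)) (poly ?p) sequentially" if "compact K" for K
      using uniform_limit_continuous_parameter[OF that \<Phi>_cont lim] by (simp only: \<Phi>_lim)
  qed
  moreover have "(\<forall>\<^sub>F m in sequentially. \<Phi> (f m) (\<alpha> m, \<beta> m) = 0) \<longleftrightarrow>
    (\<forall>\<^sub>F m in sequentially. det (\<chi> i j. (if i = j then f m + d m i else 0) - X $ i $ j + R m i j) = 0)" for f
    by (rule eventually_cong[OF ev]) auto
  ultimately show ?thesis
    by simp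
qed

section \<open>Residues of curves that are affine in the base coordinate\<close>

text \<open>Where \<open>Q\<close> does not vanish the equation says \<open>P / Q = z\<close>, and
  \<open>P / Q\<close> is locally invertible at a simple root of \<open>P\<close>; the branch is its
  inverse. At a common root of \<open>P\<close> and \<open>Q\<close> the constant branch
  works.\<close>

lemma branch_at_simple_root:
  fixes P Q :: "complex poly"
  assumes P: "poly P w0 = 0" "poly (pderiv P) w0 \<noteq> 0"
  obtains \<epsilon> w where "\<epsilon> > 0" "w holomorphic_on ball 0 \<epsilon>" "w 0 = w0"
    "\<And>z. z \<in> ball 0 \<epsilon> \<Longrightarrow> poly P (w z) = z * poly Q (w z)"
proof (cases "poly Q w0 = 0")
  case True
  show ?thesis
    by (rule that[of 1 "\<lambda>_. w0"]) (use True P in auto)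
next
  case False
  define \<psi> where "\<psi> w = poly P w / poly Q w" for w
  define S where "S = {w. poly Q w \<noteq> 0}"
  have "open S"
    unfolding S_def by (intro open_Collect_neq continuous_intros)
  have "w0 \<in> S" using False by (simp add: S_def)
  have hol: "\<psi> holomorphic_on S"
    unfolding \<psi>_def S_def by (auto intro!: holomorphic_intros)
  have "(\<psi> has_field_derivative poly (pderiv P) w0 / poly Q w0) (at w0)"
    unfolding \<psi>_def using False P(1)
    by (auto intro!: derivative_eq_intros poly_DERIV simp: field_simps)
  then have "deriv \<psi> w0 \<noteq> 0"
    using False P(2) by (simp add: DERIV_imp_deriv)
  then obtain r where r: "0 < r" "ball w0 r \<subseteq> S" "open (\<psi> ` ball w0 r)" "inj_on \<psi> (ball w0 r)"
    using has_complex_derivative_locally_invertible[OF hol \<open>w0 \<in> S\<close> \<open>open S\<close>] by metis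
  obtain w where w: "w holomorphic_on \<psi> ` ball w0 r" "\<And>z. z \<in> ball w0 r \<Longrightarrow> w (\<psi> z) = z"
    using holomorphic_has_inverse[OF holomorphic_on_subset[OF hol r(2)] open_ball r(4)] by metis
  have "\<psi> w0 = 0"
    using P by (simp add: \<psi>_def)
  then have "0 \<in> \<psi> ` ball w0 r"
    using r(1) by (metis centre_in_ball imageI)
  then obtain \<epsilon> where \<epsilon>: "\<epsilon> > 0" "ball 0 \<epsilon> \<subseteq> \<psi> ` ball w0 r"
    using r(3) open_contains_ball by blast
  show ?thesis
  proof (rule that[of \<epsilon> w])
    show "w holomorphic_on ball 0 \<epsilon>"
      using w(1) \<epsilon>(2) holomorphic_on_subset by blast
    show "w 0 = w0"
      using w(2)[of w0] r(1) \<open>\<psi> w0 = 0\<close> by simp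
    show "poly P (w z) = z * poly Q (w z)" if z: "z \<in> ball 0 \<epsilon>" for z
    proof -
      obtain v where v: "v \<in> ball w0 r" "z = \<psi> v"
        using \<epsilon>(2) z by blast
      then have "poly Q v \<noteq> 0"
        using r(2) by (auto simp: S_def)
      with v w(2) show ?thesis
        by (simp add: \<psi>_def)
    qed
  qed (use \<epsilon> in simp)
qed

text \<open>For large arguments \<open>Q\<close> is smaller than \<open>P\<close>, which contradicts
  the equation when \<open>norm z < 1\<close>. So \<open>w\<close> is bounded near 0, the
  singularity is removable, and continuity puts the value at 0 among the roots of
  \<open>P\<close>.\<close>

lemma branch_extends:
  fixes P Q :: "complex poly"
  assumes deg: "degree Q < degree P" and "\<epsilon> > 0"
    and hol: "w holomorphic_on ball 0 \<epsilon> - {0}"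
    and eq: "\<And>z. z \<in> ball 0 \<epsilon> - {0} \<Longrightarrow> poly P (w z) = z * poly Q (w z)"
  shows "\<exists>g. g holomorphic_on ball 0 \<epsilon> \<and> (\<forall>z\<in>ball 0 \<epsilon> - {0}. g z = w z) \<and> poly P (g 0) = 0"
proof -
  have "P \<noteq> 0" using deg by auto
  have "\<forall>\<^sub>F x in at_infinity. norm (poly Q x / poly P x) < 1"
    using tendstoD[OF poly_divide_tendsto_0_at_infinity[OF deg], of 1] by simp
  then obtain b where b: "\<And>x. norm x \<ge> b \<Longrightarrow> norm (poly Q x / poly P x) < 1"
    by (auto simp: eventually_at_infinity)
  \<comment> \<open>Since \<open>x / 0 = 0\<close>, the bound on the quotient says nothing at roots
    of \<open>P\<close>; these are kept away by a separate bound.\<close>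
  obtain b' where b': "\<And>x. poly P x = 0 \<Longrightarrow> norm x \<le> b'"
    using finite_imp_bounded[OF poly_roots_finite[OF \<open>P \<noteq> 0\<close>]] by (auto simp: bounded_iff)
  have bound: "norm (w z) \<le> max b b'" if z: "z \<in> ball 0 \<epsilon> - {0}" "norm z < 1" for z
  proof (rule ccontr)
    assume "\<not> ?thesis"
    then have P0: "poly P (w z) \<noteq> 0" and "norm (poly Q (w z) / poly P (w z)) < 1"
      using b[of "w z"] b'[of "w z"] by auto
    then have "norm (poly Q (w z)) < norm (poly P (w z))"
      by (simp add: norm_divide)
    also have "\<dots> = norm z * norm (poly Q (w z))"
      using eq z by (simp add: norm_mult)
    also have "\<dots> \<le> norm (poly Q (w z))"
      using z by (intro mult_left_le_one_le) auto
    finally show False by simp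
  qed
  have "\<forall>\<^sub>F z in at 0. norm (w z) \<le> max b b'"
    unfolding eventually_at
    by (intro exI[of _ "min \<epsilon> 1"]) (use \<open>\<epsilon> > 0\<close> bound in auto)
  then obtain g where g: "g holomorphic_on ball 0 \<epsilon>" "\<And>z. z \<in> ball 0 \<epsilon> - {0} \<Longrightarrow> g z = w z"
    using holomorphic_on_extend_bounded[OF hol] \<open>\<epsilon> > 0\<close> by (auto simp: interior_open)
  have g0: "isCont g 0"
    using g(1) \<open>\<epsilon> > 0\<close> holomorphic_on_imp_continuous_on continuous_on_eq_continuous_at
    by (metis centre_in_ball open_ball)
  have "((\<lambda>z. poly P (g z) - z * poly Q (g z)) \<longlongrightarrow> poly P (g 0) - 0 * poly Q (g 0)) (at 0)"
    using g0 unfolding isCont_def by (intro tendsto_intros)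
  moreover have "\<forall>\<^sub>F z in at 0. poly P (g z) - z * poly Q (g z) = 0"
    unfolding eventually_at
    by (intro exI[of _ \<epsilon>]) (use \<open>\<epsilon> > 0\<close> g(2) eq in auto)
  ultimately have "poly P (g 0) - 0 * poly Q (g 0) = 0"
    by (intro tendsto_unique[OF _ _ tendsto_eventually]) auto
  then have "poly P (g 0) = 0"
    by simp
  with g show ?thesis by blast
qed

lemma residue_divide_by_id:
  assumes "\<epsilon> > 0" "g holomorphic_on ball 0 \<epsilon>" "\<And>z. z \<in> ball 0 \<epsilon> - {0} \<Longrightarrow> f z = g z / z"
  shows "residue f 0 = g 0"
proof -
  have "residue f 0 = residue (\<lambda>z. g z / (z - 0)) 0"
    by (rule residue_cong) (use assms in \<open>auto simp: eventually_at intro!: exI[of _ \<epsilon>]\<close>)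
  also have "\<dots> = g 0"
    using assms by (intro residue_simple[of "ball 0 \<epsilon>"]) auto
  finally show ?thesis .
qed

text \<open>Every sheet extends in the coordinate \<open>z * y\<close>, so its residue is a root of
  \<open>P\<close>. Simplicity of the roots serves the other inclusion, where each root must carry a
  sheet.\<close>

lemma residues_at_0_of_curve:
  fixes P Q :: "complex poly"
  assumes deg: "degree Q < degree P"
    and simple: "\<And>w. poly P w = 0 \<Longrightarrow> poly (pderiv P) w \<noteq> 0"
    and C: "\<And>z y. z \<noteq> 0 \<Longrightarrow> (z, y) \<in> C \<longleftrightarrow> poly P (z * y) = z * poly Q (z * y)"
  shows "residues_at_0 C = {w. poly P w = 0}"
proof (intro set_eqI iffI)
  fix \<rho>
  assume "\<rho> \<in> residues_at_0 C"
  then obtain x \<epsilon> where x: "\<rho> = residue x 0" "\<epsilon> > 0" "x holomorphic_on (ball 0 \<epsilon> - {0})"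
    "\<And>z. z \<in> ball 0 \<epsilon> - {0} \<Longrightarrow> (z, x z) \<in> C"
    unfolding residues_at_0_def by blast
  have "(\<lambda>z. z * x z) holomorphic_on ball 0 \<epsilon> - {0}"
    by (intro holomorphic_intros x)
  moreover have "poly P (z * x z) = z * poly Q (z * x z)" if "z \<in> ball 0 \<epsilon> - {0}" for z
    using x(4)[OF that] that C by simp
  ultimately have "\<exists>g. g holomorphic_on ball 0 \<epsilon> \<and> (\<forall>z\<in>ball 0 \<epsilon> - {0}. g z = z * x z) \<and> poly P (g 0) = 0"
    by (rule branch_extends[OF deg \<open>\<epsilon> > 0\<close>])
  then obtain g where g: "g holomorphic_on ball 0 \<epsilon>"
    "\<And>z. z \<in> ball 0 \<epsilon> - {0} \<Longrightarrow> g z = z * x z" "poly P (g 0) = 0"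
    by blast
  then have "\<rho> = g 0"
    unfolding x(1) by (intro residue_divide_by_id[OF \<open>\<epsilon> > 0\<close>]) auto
  with g(3) show "\<rho> \<in> {w. poly P w = 0}"
    by simp
next
  fix \<rho>
  assume "\<rho> \<in> {w. poly P w = 0}"
  then obtain \<epsilon> w where w: "\<epsilon> > 0" "w holomorphic_on ball 0 \<epsilon>" "w 0 = \<rho>"
    "\<And>z. z \<in> ball 0 \<epsilon> \<Longrightarrow> poly P (w z) = z * poly Q (w z)"
    using branch_at_simple_root[of P \<rho> Q] simple by auto
  define x where "x = (\<lambda>z. w z / z)"
  have "residue x 0 = \<rho>"
    using residue_divide_by_id[OF w(1,2), of x] w(3) by (simp add: x_def)
  moreover have "x holomorphic_on (ball 0 \<epsilon> - {0})"
    unfolding x_def by (intro holomorphic_intros holomorphic_on_subset[OF w(2)]) auto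
  moreover have "\<forall>z\<in>ball 0 \<epsilon> - {0}. (z, x z) \<in> C"
    using w(4) C by (auto simp: x_def)
  ultimately show "\<rho> \<in> residues_at_0 C"
    unfolding residues_at_0_def using \<open>\<epsilon> > 0\<close> by blast
qed

text \<open>With \<open>w = 1 / z\<close> the equation becomes that of
  \<open>residues_at_0_of_curve\<close> for \<open>v = - (z * y)\<close>. The minus sign is that of
  the form at infinity, whose coefficient is then \<open>v / w\<close>.\<close>

lemma residues_at_infinity_of_curve:
  fixes P Q :: "complex poly"
  assumes deg: "degree Q < degree P"
    and simple: "\<And>w. poly P w = 0 \<Longrightarrow> poly (pderiv P) w \<noteq> 0"
    and C: "\<And>z y. z \<noteq> 0 \<Longrightarrow> (z, y) \<in> C \<longleftrightarrow> poly P (- (z * y)) = poly Q (- (z * y)) / z"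
  shows "residues_at_infinity C = {w. poly P w = 0}"
proof (intro set_eqI iffI)
  fix \<rho>
  assume "\<rho> \<in> residues_at_infinity C"
  then obtain x R where x: "\<rho> = residue (\<lambda>w. - x (1 / w) / w ^ 2) 0" "R > 0" "x holomorphic_on {z. norm z > R}"
    "\<And>z. norm z > R \<Longrightarrow> (z, x z) \<in> C"
    unfolding residues_at_infinity_def by blast
  define v where "v = (\<lambda>w. - x (1 / w) / w)"
  have large: "norm (1 / w) > R" if "w \<in> ball 0 (1 / R) - {0}" for w :: complex
    using that \<open>R > 0\<close> by (auto simp: norm_divide field_simps)
  have "(\<lambda>w. x (1 / w)) holomorphic_on ball 0 (1 / R) - {0}"
    by (rule holomorphic_on_compose_gen[OF _ x(3), unfolded o_def])
      (use large in \<open>auto intro!: holomorphic_intros\<close>)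
  then have "v holomorphic_on ball 0 (1 / R) - {0}"
    unfolding v_def by (intro holomorphic_intros) auto
  moreover have "poly P (v w) = w * poly Q (v w)" if "w \<in> ball 0 (1 / R) - {0}" for w
    using C[of "1 / w" "x (1 / w)"] x(4)[OF large[OF that]] that by (auto simp: v_def)
  ultimately have "\<exists>g. g holomorphic_on ball 0 (1 / R) \<and> (\<forall>w\<in>ball 0 (1 / R) - {0}. g w = v w) \<and> poly P (g 0) = 0"
    by (intro branch_extends[OF deg]) (use \<open>R > 0\<close> in auto)
  then obtain g where g: "g holomorphic_on ball 0 (1 / R)"
    "\<And>w. w \<in> ball 0 (1 / R) - {0} \<Longrightarrow> g w = v w" "poly P (g 0) = 0"
    by blast
  then have "\<rho> = g 0"
    unfolding x(1) using \<open>R > 0\<close>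
    by (intro residue_divide_by_id[of "1 / R"]) (auto simp: v_def power2_eq_square)
  with g(3) show "\<rho> \<in> {w. poly P w = 0}"
    by simp
next
  fix \<rho>
  assume "\<rho> \<in> {w. poly P w = 0}"
  then obtain \<epsilon> w where w: "\<epsilon> > 0" "w holomorphic_on ball 0 \<epsilon>" "w 0 = \<rho>"
    "\<And>z. z \<in> ball 0 \<epsilon> \<Longrightarrow> poly P (w z) = z * poly Q (w z)"
    using branch_at_simple_root[of P \<rho> Q] simple by auto
  define x where "x = (\<lambda>z. - w (1 / z) / z)"
  have small: "1 / z \<in> ball 0 \<epsilon>" "z \<noteq> 0" if "norm z > 1 / \<epsilon>" for z :: complex
  proof -
    show "z \<noteq> 0" using that \<open>\<epsilon> > 0\<close> by auto
    then show "1 / z \<in> ball 0 \<epsilon>"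
      using that \<open>\<epsilon> > 0\<close> by (auto simp: norm_divide field_simps)
  qed
  have "residue (\<lambda>w. - x (1 / w) / w ^ 2) 0 = \<rho>"
    using residue_divide_by_id[OF w(1,2), of "\<lambda>w. - x (1 / w) / w ^ 2"] w(3)
    by (simp add: x_def power2_eq_square)
  moreover have "(\<lambda>z. w (1 / z)) holomorphic_on {z. norm z > 1 / \<epsilon>}"
    by (rule holomorphic_on_compose_gen[OF _ w(2), unfolded o_def])
      (use small in \<open>auto intro!: holomorphic_intros\<close>)
  then have "x holomorphic_on {z. norm z > 1 / \<epsilon>}"
    unfolding x_def by (intro holomorphic_intros) (use small in auto)
  moreover have "\<forall>z. norm z > 1 / \<epsilon> \<longrightarrow> (z, x z) \<in> C"
    using w(4) C small by (auto simp: x_def)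
  moreover have "1 / \<epsilon> > 0"
    using \<open>\<epsilon> > 0\<close> by simp
  ultimately show "\<rho> \<in> residues_at_infinity C"
    unfolding residues_at_infinity_def by blast
qed

section \<open>Components of the degenerate spectral curve\<close>

lemma block_char_poly_eq_block_poly: "block_char_poly k X = block_poly {..ix k} X"
  unfolding block_char_poly_def block_poly_def block_det_def
  by (intro arg_cong[where f = det]) (auto simp: vec_eq_iff)

text \<open>The indices up to entry \<open>k - 1\<close> of the increasing enumeration are its first
  \<open>k\<close> entries. Hence the \<open>k\<close>-th block polynomial has degree
  \<open>k\<close>.\<close>

lemma card_atMost_ix:
  assumes "1 \<le> k" "k \<le> CARD('n)"
  shows "card {..ix k :: 'n::{finite,linorder}} = k"
proof -
  let ?L = "sorted_list_of_set (UNIV :: 'n set)"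
  have L: "sorted_wrt (<) ?L" "set ?L = UNIV" "length ?L = CARD('n)" "distinct ?L"
    by simp_all
  have "{..?L ! (k - 1)} = (!) ?L ` {..<k}"
  proof (intro equalityI subsetI)
    fix x
    assume x: "x \<in> {..?L ! (k - 1)}"
    obtain j where j: "j < CARD('n)" "x = ?L ! j"
      using L(2,3) by (metis UNIV_I in_set_conv_nth)
    have "j < k"
    proof (rule ccontr)
      assume "\<not> j < k"
      then have "?L ! (k - 1) < ?L ! j"
        using sorted_wrt_nth_less[OF L(1), of "k - 1" j] j assms L(3) by auto
      with x j show False by auto
    qed
    with j show "x \<in> (!) ?L ` {..<k}" by auto
  next
    fix x
    assume "x \<in> (!) ?L ` {..<k}"
    then obtain j where j: "j < k" "x = ?L ! j" by auto
    show "x \<in> {..?L ! (k - 1)}"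
    proof (cases "j = k - 1")
      case False
      then have "j < k - 1" "k - 1 < length ?L"
        using j assms L(3) by auto
      from sorted_wrt_nth_less[OF L(1) this] show ?thesis
        using j by (simp add: less_imp_le)
    qed (use j in auto)
  qed
  moreover have "inj_on ((!) ?L) {..<k}"
    using L(3,4) assms by (auto intro!: inj_on_nth)
  ultimately show ?thesis
    unfolding ix_def by (simp add: card_image)
qed

lemma atMost_ix_CARD: "{..ix CARD('n) :: 'n::{finite,linorder}} = UNIV"
  by (rule card_subset_eq) (simp_all add: card_atMost_ix Suc_le_eq)

section \<open>Simplicity of the block spectra under strict interlacing\<close>

text \<open>Two neighbouring eigenvalues of a block are separated by one of the next larger block
  or, for the full matrix, of the next smaller one.\<close>

lemma mu_strictly_decreasing:
  fixes X :: "'n::{finite,linorder} cmat"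
  assumes X: "strictly_interlacing X" and ik: "1 \<le> i" "i < k" "k \<le> CARD('n)"
  shows "mu X k (Suc i) < mu X k i"
proof (cases "k < CARD('n)")
  case True
  then have "mu X (Suc k) (Suc i) < mu X k i" "mu X k (Suc i) < mu X (Suc k) (Suc i)"
    using X ik unfolding strictly_interlacing_def by auto
  then show ?thesis by simp
next
  case False
  obtain k' where k': "k = Suc k'"
    using ik by (cases k) auto
  then have "mu X k' i < mu X k i" "mu X k (Suc i) < mu X k' i"
    using X ik unfolding strictly_interlacing_def by auto
  then show ?thesis by simp
qed

text \<open>Read backwards, the list consists of the numbers \<open>mu X k i\<close>, which strictly
  decrease in \<open>i\<close>.\<close>

lemma distinct_eigenvalues:
  fixes X :: "'n::{finite,linorder} cmat"
  assumes X: "strictly_interlacing X" and k: "1 \<le> k" "k \<le> CARD('n)"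
  shows "distinct (sorted_list_of_multiset (image_mset Re (proots (block_poly {..ix k} X))))"
proof -
  let ?L = "rev (sorted_list_of_multiset (image_mset Re (proots (block_poly {..ix k} X))))"
  have len: "length ?L = k"
    using k by (simp add: size_mset[symmetric] size_proots_complex degree_block_poly card_atMost_ix
        del: size_mset)
  have mu: "mu X k (Suc i) = ?L ! i" if "i < k" for i
    using that k by (simp add: mu_def in_tri_def block_char_poly_eq_block_poly)
  have "?L ! Suc i < ?L ! i" if "Suc i < k" for i
    using mu_strictly_decreasing[OF X _ that k(2)] mu[of i] mu[of "Suc i"] that by simp
  then have "sorted_wrt (>) ?L"
    unfolding sorted_wrt_iff_nth_Suc_transp[OF transp_on_greater] len by blast
  then show ?thesis
    unfolding sorted_wrt_rev strict_sorted_iff by simp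
qed

text \<open>A multiple root would repeat its real part in a list without repetitions.\<close>

lemma simple_eigenvalues:
  fixes X :: "'n::{finite,linorder} cmat"
  assumes X: "strictly_interlacing X" and k: "1 \<le> k" "k \<le> CARD('n)"
    and w: "poly (block_poly {..ix k} X) w = 0"
  shows "poly (pderiv (block_poly {..ix k} X)) w \<noteq> 0"
proof -
  let ?p = "block_poly {..ix k} X"
  let ?M = "image_mset Re (proots ?p)"
  have "order a ?p \<le> 1" for a
  proof -
    have "order a ?p = count (proots ?p) a"
      by (simp add: block_poly_nonzero)
    \<comment> \<open>Passing to real parts can only merge roots, so multiplicities do not
      drop.\<close>
    also have "\<dots> \<le> count ?M (Re a)"
    proof (cases "a \<in># proots ?p")
      case True
      then show ?thesis
        unfolding count_image_mset by (intro member_le_sum) auto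
    qed (simp add: not_in_iff)
    also have "\<dots> = count (mset (sorted_list_of_multiset ?M)) (Re a)"
      by simp
    also have "\<dots> \<le> 1"
      using distinct_eigenvalues[OF X k] by (simp only: distinct_count_atmost_1) simp
    finally show ?thesis .
  qed
  then have "rsquarefree ?p"
    unfolding rsquarefree_def by (auto simp: block_poly_nonzero le_Suc_eq)
  then show ?thesis
    using w rsquarefree_roots by blast
qed

text \<open>One side sorts a set and the other a multiset; they agree because the real parts of the
  roots are distinct.\<close>

lemma ordered_residues_eq_mu:
  fixes X :: "'n::{finite,linorder} cmat"
  assumes X: "strictly_interlacing X"
    and R: "\<And>k. 1 \<le> k \<Longrightarrow> k \<le> CARD('n) \<Longrightarrow> R k = {w. poly (block_poly {..ix k} X) w = 0}"
  shows "ordered_residues CARD('n) R = mu X"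
proof (intro ext)
  fix k i
  show "ordered_residues CARD('n) R k i = mu X k i"
  proof (cases "in_tri CARD('n) k i")
    case True
    then have k: "1 \<le> k" "k \<le> CARD('n)"
      by (auto simp: in_tri_def)
    let ?M = "image_mset Re (proots (block_poly {..ix k} X))"
    have "Re ` R k = set (sorted_list_of_multiset ?M)"
      by (simp add: R[OF k] block_poly_nonzero)
    then have "sorted_list_of_set (Re ` R k) = sorted_list_of_multiset ?M"
      by (simp only: sorted_list_of_set.idem_if_sorted_distinct[OF sorted_sorted_list_of_multiset distinct_eigenvalues[OF X k]])
    then show ?thesis
      using True by (simp add: ordered_residues_def mu_def block_char_poly_eq_block_poly)
  qed (simp add: ordered_residues_def mu_def)
qed

section \<open>Equations of the components on both sides of the degeneration\<close>

text \<open>The common form of both sides: \<open>v\<close> is \<open>u\<close> or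
  \<open>La\<close>, the scale is set by \<open>v m k\<close>, and \<open>R\<close> holds the
  contribution of the other irregular point, which dies out. The diagonal terms tend to 0 before
  \<open>k\<close>, to \<open>c\<close> at \<open>k\<close>, and to infinity beyond.\<close>

lemma limit_curve_iff:
  fixes X :: "'n::{finite,linorder} cmat" and v :: "nat \<Rightarrow> 'n \<Rightarrow> real"
  assumes nz: "\<And>i. \<forall>\<^sub>F m in sequentially. v m i \<noteq> 0"
    and ratio: "\<And>i j. i < j \<Longrightarrow> (\<lambda>m. v m i / v m j) \<longlonglongrightarrow> 0"
    and R: "\<And>i j. (\<lambda>m. R m i j) \<longlonglongrightarrow> 0"
    and "a \<noteq> 0" "c \<noteq> 0" "z \<noteq> 0"
    and C: "\<forall>\<^sub>F m in sequentially. \<forall>x. (z, x) \<in> C m \<longleftrightarrow>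
      det (\<chi> i j. (if i = j then a * x + c * of_real (v m i / v m k) else 0) - X $ i $ j + R m i j) = 0"
  shows "(z, y) \<in> limit_curve C \<longleftrightarrow>
    poly (block_poly {..k} X) (a * y) + c * poly (block_poly {..<k} X) (a * y) = 0"
proof -
  define d where "d m i = c * complex_of_real (v m i / v m k)" for m i
  have d_below: "(\<lambda>m. d m i) \<longlonglongrightarrow> 0" if "i < k" for i
    unfolding d_def using tendsto_mult[OF tendsto_const[of c] tendsto_of_real[OF ratio[OF that]]] by simp
  have d_at: "(\<lambda>m. d m k) \<longlonglongrightarrow> c"
    by (rule tendsto_eventually) (use nz[of k] in \<open>auto elim!: eventually_mono simp: d_def\<close>)
  have d_above: "(\<lambda>m. inverse (d m i)) \<longlonglongrightarrow> 0" if "k < i" for i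
  proof -
    have "inverse (d m i) = inverse c * complex_of_real (v m k / v m i)" for m
      by (simp add: d_def field_simps)
    then show ?thesis
      using tendsto_mult[OF tendsto_const[of "inverse c"] tendsto_of_real[OF ratio[OF that]]] by simp
  qed
  have d_nz: "\<forall>\<^sub>F m in sequentially. d m i \<noteq> 0" for i
    using nz[of i] nz[of k] by eventually_elim (use \<open>c \<noteq> 0\<close> in \<open>simp add: d_def\<close>)
  let ?D = "\<lambda>m x. det (\<chi> i j. (if i = j then x + d m i else 0) - X $ i $ j + R m i j) = 0"
  have "(z, y) \<in> limit_curve C \<longleftrightarrow> (\<exists>f. (\<forall>\<^sub>F m in sequentially. ?D m (a * f m)) \<and> f \<longlonglongrightarrow> y)"
  proof -
    have "(\<forall>\<^sub>F m in sequentially. (z, f m) \<in> C m) \<longleftrightarrow> (\<forall>\<^sub>F m in sequentially. ?D m (a * f m))" for f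
      by (rule eventually_cong[OF C]) (simp only: d_def)
    then show ?thesis
      using \<open>z \<noteq> 0\<close> by (simp add: limit_curve_def)
  qed
  also have "\<dots> \<longleftrightarrow> (\<exists>f. (\<forall>\<^sub>F m in sequentially. ?D m (f m)) \<and> f \<longlonglongrightarrow> a * y)"
  proof
    assume "\<exists>f. (\<forall>\<^sub>F m in sequentially. ?D m (a * f m)) \<and> f \<longlonglongrightarrow> y"
    then obtain f where "\<forall>\<^sub>F m in sequentially. ?D m (a * f m)" "f \<longlonglongrightarrow> y"
      by (elim exE conjE)
    then show "\<exists>f. (\<forall>\<^sub>F m in sequentially. ?D m (f m)) \<and> f \<longlonglongrightarrow> a * y"
      by (intro exI[of _ "\<lambda>m. a * f m"] conjI tendsto_intros)
  next
    assume "\<exists>f. (\<forall>\<^sub>F m in sequentially. ?D m (f m)) \<and> f \<longlonglongrightarrow> a * y"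
    then obtain f where f: "\<forall>\<^sub>F m in sequentially. ?D m (f m)" "f \<longlonglongrightarrow> a * y"
      by (elim exE conjE)
    have "(\<lambda>m. f m / a) \<longlonglongrightarrow> y"
      using tendsto_divide[OF f(2) tendsto_const \<open>a \<noteq> 0\<close>] \<open>a \<noteq> 0\<close> by simp
    then show "\<exists>f. (\<forall>\<^sub>F m in sequentially. ?D m (a * f m)) \<and> f \<longlonglongrightarrow> y"
    proof (intro exI[of _ "\<lambda>m. f m / a"] conjI)
      have "a * (f m / a) = f m" for m
        using \<open>a \<noteq> 0\<close> by simp
      then show "\<forall>\<^sub>F m in sequentially. ?D m (a * (f m / a))"
        using f(1) by (simp only:)
    qed
  qed
  also have "\<dots> \<longleftrightarrow> poly (block_poly {..k} X) (a * y) + c * poly (block_poly {..<k} X) (a * y) = 0"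
    by (rule converging_det_zeros_iff[where d = d and R = R and c = c, OF d_below d_at d_above d_nz R])
  finally show ?thesis .
qed

lemma sandwich_diag: "(g ** diag d ** h) $ i $ j = (\<Sum>k\<in>UNIV. g $ i $ k * of_real (d k) * h $ k $ j)"
  by (simp add: matrix_matrix_mult_def diag_def if_distrib if_distribR sum.delta cong: if_cong)

lemma sandwich_diag_tendsto_0:
  fixes d :: "nat \<Rightarrow> 'n::finite \<Rightarrow> real"
  assumes "\<And>k. (\<lambda>m. d m k * e m) \<longlonglongrightarrow> 0"
  shows "(\<lambda>m. (g ** diag (d m) ** h) $ i $ j * of_real (e m)) \<longlonglongrightarrow> 0"
proof -
  have "(\<lambda>m. \<Sum>k\<in>UNIV. g $ i $ k * of_real (d m k * e m) * h $ k $ j) \<longlonglongrightarrow> (\<Sum>k\<in>UNIV. g $ i $ k * of_real 0 * h $ k $ j)"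
    by (intro tendsto_intros assms)
  then show ?thesis
    by (simp add: sandwich_diag sum_distrib_left mult_ac)
qed

lemma det_conj_unitary:
  assumes "unitary g"
  shows "det (g ** N ** adj g) = det N"
proof -
  have "det g * det (adj g) = 1"
    using assms by (metis det_I det_mul unitary_def)
  then show ?thesis
    by (simp add: det_mul mult.commute mult.left_commute)
qed

text \<open>The four terms match the spectral matrix, so that conjugation by the frame can be
  carried out term by term.\<close>

lemma sandwich_linear:
  fixes g h :: "'n::finite cmat"
  shows "(g ** (\<chi> i j. a * I $ i $ j + b * B $ i $ j + c * A $ i $ j + d * U $ i $ j) ** h) $ i $ j
    = a * (g ** I ** h) $ i $ j + b * (g ** B ** h) $ i $ j + c * (g ** A ** h) $ i $ j + d * (g ** U ** h) $ i $ j"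
proof -
  have "g ** (\<chi> i j. a * I $ i $ j + b * B $ i $ j + c * A $ i $ j + d * U $ i $ j)
    = (\<chi> i j. a * (g ** I) $ i $ j + b * (g ** B) $ i $ j + c * (g ** A) $ i $ j + d * (g ** U) $ i $ j)"
    by (simp add: matrix_matrix_mult_def vec_eq_iff sum.distrib sum_distrib_left distrib_left mult.left_commute)
  moreover have "((\<chi> i j. a * I $ i $ j + b * B $ i $ j + c * A $ i $ j + d * U $ i $ j) ** h) $ i $ j
    = a * (I ** h) $ i $ j + b * (B ** h) $ i $ j + c * (A ** h) $ i $ j + d * (U ** h) $ i $ j" for I B A U :: "'n cmat"
    by (simp add: matrix_matrix_mult_def sum.distrib sum_distrib_left distrib_right mult.assoc)
  ultimately show ?thesis
    by simp
qed

text \<open>After multiplication by z over \<open>u m (ix k)\<close>, the rescaled spectral matrix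
  has diagonal terms \<open>z * x\<close> and \<open>- \<i> * z * (u m i / u m (ix k))\<close>,
  constant part \<open>B\<close>, and an \<open>A\<close> term of size \<open>La * u\<close>, which
  vanishes in the limit. So \<open>c = - \<i> * z\<close>.\<close>

lemma mem_component12_iff:
  fixes lam :: "'n::{finite,linorder} \<Rightarrow> real"
  assumes fam: "caterpillar_family lam u La" and "z \<noteq> 0"
  shows "(z, y) \<in> component12 u La (A, F, B) k \<longleftrightarrow>
    poly (block_poly {..ix k} (- B)) (z * y) = z * poly (smult \<i> (block_poly {..<ix k} (- B))) (z * y)"
proof -
  let ?\<kappa> = "ix k :: 'n"
  let ?A = "\<lambda>m. adj (gF F) ** diag (La m) ** gF F"
  have nz: "\<forall>\<^sub>F m in sequentially. u m i \<noteq> 0" for i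
    using fam unfolding caterpillar_family_def by (auto elim: eventually_mono)
  have ratio: "(\<lambda>m. u m i / u m j) \<longlonglongrightarrow> 0" if "i < j" for i j
    using fam that unfolding caterpillar_family_def by blast
  have uLa: "(\<lambda>m. La m l * u m ?\<kappa>) \<longlonglongrightarrow> 0" for l
    using fam unfolding caterpillar_family_def by (simp add: mult.commute)
  let ?R = "\<lambda>m i j. ?A m $ i $ j * of_real (u m ?\<kappa>) / z"
  have R: "(\<lambda>m. ?R m i j) \<longlonglongrightarrow> 0" for i j
    using tendsto_divide[OF sandwich_diag_tendsto_0[OF uLa] tendsto_const \<open>z \<noteq> 0\<close>] by simp
  have "\<forall>\<^sub>F m in sequentially. \<forall>x.
      (z, x) \<in> rescale (1 / u m ?\<kappa>) (spectral_family u La (A, F, B) m) \<longleftrightarrow>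
      det (\<chi> i j. (if i = j then z * x + - \<i> * z * of_real (u m i / u m ?\<kappa>) else 0)
        - (- B) $ i $ j + ?R m i j) = 0"
    using nz[of ?\<kappa>]
  proof eventually_elim
    case (elim m)
    let ?u = "complex_of_real (u m ?\<kappa>)"
    have "?u \<noteq> 0" using elim by simp
    show ?case
    proof
      fix x
      let ?N = "\<chi> i j. mat (x * ?u) $ i $ j - (\<i> * diag (u m) $ i $ j - B $ i $ j / (z / ?u)
        - ?A m $ i $ j / (z / ?u) ^ 2)"
      have "(\<chi> i j. (if i = j then z * x + - \<i> * z * of_real (u m i / u m ?\<kappa>) else 0)
        - (- B) $ i $ j + ?R m i j) = (\<chi> i j. (z / ?u) * ?N $ i $ j)"
        using \<open>?u \<noteq> 0\<close> \<open>z \<noteq> 0\<close>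
        by (simp add: vec_eq_iff mat_def diag_def field_simps power2_eq_square)
      moreover have "(z, x) \<in> rescale (1 / u m ?\<kappa>) (spectral_family u La (A, F, B) m) \<longleftrightarrow> det ?N = 0"
        using \<open>?u \<noteq> 0\<close> \<open>z \<noteq> 0\<close>
        by (simp add: rescale_def spectral_family_def spectral_curve_def)
      ultimately show "(z, x) \<in> rescale (1 / u m ?\<kappa>) (spectral_family u La (A, F, B) m) \<longleftrightarrow>
        det (\<chi> i j. (if i = j then z * x + - \<i> * z * of_real (u m i / u m ?\<kappa>) else 0)
          - (- B) $ i $ j + ?R m i j) = 0"
        using \<open>?u \<noteq> 0\<close> \<open>z \<noteq> 0\<close> by (simp only: det_scale) simp
    qed
  qed
  from limit_curve_iff[OF nz ratio R \<open>z \<noteq> 0\<close> _ \<open>z \<noteq> 0\<close> this, of y]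
  show ?thesis
    using \<open>z \<noteq> 0\<close> unfolding component12_def by (simp add: algebra_simps)
qed

text \<open>Conjugation by the frame makes \<open>A\<close> diagonal and turns \<open>B\<close> into
  \<open>X\<close>. Multiplying by \<open>- z\<close> times \<open>La m (ix k)\<close> gives the
  shape of \<open>limit_curve_iff\<close> with \<open>a = - z\<close> and
  \<open>c = - (1 / z)\<close>, while the \<open>u\<close> term vanishes in the limit.\<close>

lemma mem_component21_iff:
  fixes lam :: "'n::{finite,linorder} \<Rightarrow> real" and F B :: "'n cmat"
  assumes fam: "caterpillar_family lam u La" and g: "unitary (gF F)" and "z \<noteq> 0"
  defines "X \<equiv> gF F ** B ** adj (gF F)"
  shows "(z, y) \<in> component21 u La (A, F, B) k \<longleftrightarrow>
    poly (block_poly {..ix k} X) (- (z * y)) = poly (block_poly {..<ix k} X) (- (z * y)) / z"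
proof -
  let ?g = "gF F"
  let ?\<kappa> = "ix k :: 'n"
  have nz: "\<forall>\<^sub>F m in sequentially. La m i \<noteq> 0" for i
    using fam unfolding caterpillar_family_def by (auto elim: eventually_mono)
  have ratio: "(\<lambda>m. La m i / La m j) \<longlonglongrightarrow> 0" if "i < j" for i j
    using fam that unfolding caterpillar_family_def by blast
  have uLa: "(\<lambda>m. u m l * La m ?\<kappa>) \<longlonglongrightarrow> 0" for l
    using fam unfolding caterpillar_family_def by simp
  let ?R = "\<lambda>m i j. (?g ** diag (u m) ** adj ?g) $ i $ j * of_real (La m ?\<kappa>) * (\<i> * z)"
  have R: "(\<lambda>m. ?R m i j) \<longlonglongrightarrow> 0" for i j
    using tendsto_mult[OF sandwich_diag_tendsto_0[OF uLa] tendsto_const[of "\<i> * z"]] by simp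
  have "\<forall>\<^sub>F m in sequentially. \<forall>x.
      (z, x) \<in> rescale (La m ?\<kappa>) (spectral_family u La (A, F, B) m) \<longleftrightarrow>
      det (\<chi> i j. (if i = j then - z * x + - (1 / z) * of_real (La m i / La m ?\<kappa>) else 0)
        - X $ i $ j + ?R m i j) = 0"
    using nz[of ?\<kappa>]
  proof eventually_elim
    case (elim m)
    let ?l = "complex_of_real (La m ?\<kappa>)"
    let ?A = "adj ?g ** diag (La m) ** ?g"
    have "?l \<noteq> 0" using elim by simp
    have gA: "?g ** ?A ** adj ?g = diag (La m)" and gI: "?g ** mat 1 ** adj ?g = mat 1"
      using g unfolding unitary_def by (metis matrix_mul_assoc matrix_mul_lid matrix_mul_rid)+
    show ?case
    proof
      fix x
      let ?N = "(\<chi> i j. (x / ?l) * mat 1 $ i $ j + 1 / (?l * z) * B $ i $ j + 1 / (?l * z)^2 * ?A $ i $ j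
        + - \<i> * diag (u m) $ i $ j) :: 'n cmat"
      have "(\<chi> i j. (if i = j then - z * x + - (1 / z) * of_real (La m i / La m ?\<kappa>) else 0)
        - X $ i $ j + ?R m i j) = (\<chi> i j. (- ?l * z) * (?g ** ?N ** adj ?g) $ i $ j)"
        unfolding sandwich_linear gA gI
        using \<open>?l \<noteq> 0\<close> \<open>z \<noteq> 0\<close>
        by (simp add: vec_eq_iff mat_def diag_def X_def field_simps power2_eq_square)
      moreover have "(z, x) \<in> rescale (La m ?\<kappa>) (spectral_family u La (A, F, B) m) \<longleftrightarrow> det ?N = 0"
      proof -
        have "(\<chi> i j. mat (x / ?l) $ i $ j - (\<i> * diag (u m) $ i $ j - B $ i $ j / (?l * z)
          - ?A $ i $ j / (?l * z) ^ 2)) = ?N"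
          by (simp add: vec_eq_iff mat_def)
        then show ?thesis
          using \<open>?l \<noteq> 0\<close> \<open>z \<noteq> 0\<close>
          by (simp add: rescale_def spectral_family_def spectral_curve_def)
      qed
      ultimately show "(z, x) \<in> rescale (La m ?\<kappa>) (spectral_family u La (A, F, B) m) \<longleftrightarrow>
        det (\<chi> i j. (if i = j then - z * x + - (1 / z) * of_real (La m i / La m ?\<kappa>) else 0)
          - X $ i $ j + ?R m i j) = 0"
        using \<open>?l \<noteq> 0\<close> \<open>z \<noteq> 0\<close> by (simp only: det_scale det_conj_unitary[OF g]) simp
    qed
  qed
  from limit_curve_iff[OF nz ratio R _ _ \<open>z \<noteq> 0\<close> this, of y]
  show ?thesis
    using \<open>z \<noteq> 0\<close> unfolding component21_def by (simp add: field_simps)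
qed

lemma card_lessThan_less_atMost: "card {..<k} < card {..k::'n::{finite,linorder}}"
  by (rule psubset_card_mono) auto

lemma phi_spec_eq_mu:
  fixes lam :: "'n::{finite,linorder} \<Rightarrow> real"
  assumes fam: "caterpillar_family lam u La" and g: "unitary (gF F)"
    and sreg: "strictly_interlacing (gF F ** B ** adj (gF F))" "strictly_interlacing (- B)"
  shows "phi_spec u La (A, F, B) = (mu (gF F ** B ** adj (gF F)), mu (- B))"
proof -
  have "residues_at_infinity (component21 u La (A, F, B) k)
      = {w. poly (block_poly {..ix k} (gF F ** B ** adj (gF F))) w = 0}"
    if "1 \<le> k" "k \<le> CARD('n)" for k
    by (rule residues_at_infinity_of_curve[OF _ simple_eigenvalues[OF sreg(1) that] mem_component21_iff[OF fam g]])
      (simp_all add: degree_block_poly card_lessThan_less_atMost)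
  moreover have "residues_at_0 (component12 u La (A, F, B) k) = {w. poly (block_poly {..ix k} (- B)) w = 0}"
    if "1 \<le> k" "k \<le> CARD('n)" for k
    by (rule residues_at_0_of_curve[OF _ simple_eigenvalues[OF sreg(2) that] mem_component12_iff[OF fam]])
      (simp_all add: degree_block_poly card_lessThan_less_atMost)
  ultimately show ?thesis
    unfolding phi_spec_def by (simp add: ordered_residues_eq_mu sreg)
qed

section \<open>Spectra of opposite and of conjugate matrices\<close>

lemma poly_block_poly_UNIV: "poly (block_poly UNIV X) w = det (\<chi> i j. (if i = j then w else 0) - X $ i $ j)"
  by (simp add: poly_block_poly block_det_UNIV)

lemma block_poly_UNIV_conj:
  assumes "unitary g"
  shows "block_poly UNIV (g ** B ** adj g) = block_poly UNIV B"
proof -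
  have "poly (block_poly UNIV (g ** B ** adj g)) w = poly (block_poly UNIV B) w" for w
  proof -
    \<comment> \<open>The zero terms bring the characteristic matrix into the four-term shape of
      \<open>sandwich_linear\<close>.\<close>
    let ?N = "(\<chi> i j. w * mat 1 $ i $ j + (-1) * B $ i $ j + 0 * B $ i $ j + 0 * B $ i $ j) :: 'a cmat"
    have "g ** mat 1 ** adj g = mat 1"
      using assms by (simp add: unitary_def)
    then have "g ** ?N ** adj g = (\<chi> i j. (if i = j then w else 0) - (g ** B ** adj g) $ i $ j)"
      unfolding vec_eq_iff sandwich_linear by (simp add: mat_def)
    moreover have "?N = (\<chi> i j. (if i = j then w else 0) - B $ i $ j)"
      by (simp add: vec_eq_iff mat_def)
    ultimately show ?thesis
      unfolding poly_block_poly_UNIV using det_conj_unitary[OF assms, of ?N] by (simp only:)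
  qed
  then show ?thesis
    by (intro poly_eq_poly_eq_iff[THEN iffD1] ext)
qed

lemma poly_prod_roots_reflect:
  "poly (\<Prod>x\<in>#M. [:x, 1:]) (w :: complex) = (-1) ^ size M * poly (\<Prod>x\<in>#M. [:- x, 1:]) (- w)"
  by (induction M) (simp_all add: algebra_simps)

lemma proots_prod_linear: "proots (\<Prod>x\<in>#M. [:x, 1:]) = image_mset uminus (M :: 'a::idom multiset)"
proof (induction M)
  case (add x M)
  have "(\<Prod>x\<in>#M. [:x, 1:]) \<noteq> 0"
    by (auto simp: prod_mset_zero_iff)
  then show ?case
    using add proots_mult[of "[:x, 1:]" "\<Prod>x\<in>#M. [:x, 1:]"] by (simp add: proots_linear_factor del: mult_pCons_left)
qed simp

text \<open>Pulling -1 out of every row relates the two characteristic polynomials by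
  \<open>w\<close> to \<open>- w\<close> and a sign; reflecting the linear factors of one gives
  those of the other, with multiplicities.\<close>

lemma proots_block_poly_UNIV_uminus:
  fixes B :: "'n::finite cmat"
  shows "proots (block_poly UNIV (- B)) = image_mset uminus (proots (block_poly UNIV B))"
proof -
  let ?M = "proots (block_poly UNIV B)"
  have B: "block_poly UNIV B = (\<Prod>x\<in>#?M. [:- x, 1:])"
    using complex_poly_decompose_multiset[of "block_poly UNIV B"] by (simp add: lead_coeff_block_poly)
  have size: "size ?M = CARD('n)"
    by (simp add: size_proots_complex degree_block_poly)
  have "poly (block_poly UNIV (- B)) w = poly (\<Prod>x\<in>#?M. [:x, 1:]) w" for w
  proof -
    have "(\<chi> i j. (if i = j then w else 0) - (- B) $ i $ j)
      = (\<chi> i j. (-1) * (\<chi> i j. (if i = j then - w else 0) - B $ i $ j) $ i $ j)"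
      by (simp add: vec_eq_iff)
    then have "poly (block_poly UNIV (- B)) w = (-1) ^ CARD('n) * poly (block_poly UNIV B) (- w)"
      unfolding poly_block_poly_UNIV det_scale[symmetric] by simp
    then show ?thesis
      unfolding poly_prod_roots_reflect size by (subst (asm) B)
  qed
  then have "block_poly UNIV (- B) = (\<Prod>x\<in>#?M. [:x, 1:])"
    by (intro poly_eq_poly_eq_iff[THEN iffD1] ext)
  then have "proots (block_poly UNIV (- B)) = proots (\<Prod>x\<in>#?M. [:x, 1:])"
    by simp
  also have "\<dots> = image_mset uminus ?M"
    by (rule proots_prod_linear)
  finally show ?thesis .
qed

text \<open>Conjugation keeps the spectrum of \<open>B\<close>, while negation reverses its order.
  This relation between the top rows is what places the values in the annihilator.\<close>

lemma mu_top_row_uminus_conj: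
  fixes B :: "'n::{finite,linorder} cmat"
  assumes "unitary g" and i: "1 \<le> i" "i \<le> CARD('n)"
  shows "mu (- B) CARD('n) (CARD('n) + 1 - i) = - mu (g ** B ** adj g) CARD('n) i"
proof -
  let ?n = "CARD('n)"
  let ?M = "image_mset Re (proots (block_poly UNIV B))"
  let ?L = "sorted_list_of_multiset ?M"
  have len: "length ?L = ?n"
    by (simp add: size_mset[symmetric] size_proots_complex degree_block_poly del: size_mset)
  have "sorted_list_of_multiset (image_mset uminus ?M) = sort (map uminus ?L)"
    by (metis mset_map mset_sorted_list_of_multiset sorted_list_of_multiset_mset)
  also have "\<dots> = rev (map uminus ?L)"
  proof (rule properties_for_sort)
    have "sorted_wrt (\<le>) ?L"
      by simp
    then show "sorted (rev (map uminus ?L))"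
      unfolding sorted_wrt_rev sorted_wrt_map by (rule sorted_wrt_mono_rel[rotated]) simp
  qed simp
  finally have L: "sorted_list_of_multiset (image_mset uminus ?M) = rev (map uminus ?L)" .
  \<comment> \<open>\<open>mu\<close> reverses the ascending list, which is itself a reversal here,
    and counts from 1; so place \<open>n + 1 - i\<close> is position \<open>n - i\<close> of the
    negated list.\<close>
  have "mu (- B) ?n (?n + 1 - i) = map uminus ?L ! (?n - i)"
  proof -
    have "image_mset Re (proots (block_poly UNIV (- B))) = image_mset uminus ?M"
      by (simp add: proots_block_poly_UNIV_uminus image_mset.compositionality o_def)
    moreover have "in_tri ?n ?n (?n + 1 - i)"
      using i unfolding in_tri_def by arith
    ultimately show ?thesis
      using L by (simp add: mu_def block_char_poly_eq_block_poly atMost_ix_CARD)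
  qed
  also have "\<dots> = - (?L ! (?n - i))"
    using len i by (intro nth_map) simp
  also have "?L ! (?n - i) = mu (g ** B ** adj g) ?n i"
    using i len by (simp add: mu_def in_tri_def block_char_poly_eq_block_poly atMost_ix_CARD
        block_poly_UNIV_conj[OF assms(1)] rev_nth)
  finally show ?thesis .
qed

section \<open>Membership in the annihilator\<close>

text \<open>Elements of \<open>Lie_G n\<close> live in row \<open>n\<close>. Reversing the summation
  index in the second half of the pairing makes the two halves cancel.\<close>

lemma mem_Lie_G_perpI:
  assumes n: "1 \<le> n" and tri: "a \<in> tri_space n" "b \<in> tri_space n"
    and top: "\<And>i. 1 \<le> i \<Longrightarrow> i \<le> n \<Longrightarrow> b n (n + 1 - i) = - a n i"
  shows "(a, b) \<in> Lie_G_perp n"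
proof -
  have "(\<Sum>k=1..n. \<Sum>i=1..k. a k i * top_row n x k i + b k i * top_row n (\<lambda>i. x (n + 1 - i)) k i) = 0" for x
  proof -
    have "(\<Sum>k=1..n. \<Sum>i=1..k. a k i * top_row n x k i + b k i * top_row n (\<lambda>i. x (n + 1 - i)) k i)
      = (\<Sum>k=1..n. if k = n then \<Sum>i=1..n. a n i * x i + b n i * x (n + 1 - i) else 0)"
    proof (rule sum.cong[OF refl])
      fix k
      show "(\<Sum>i=1..k. a k i * top_row n x k i + b k i * top_row n (\<lambda>i. x (n + 1 - i)) k i)
        = (if k = n then \<Sum>i=1..n. a n i * x i + b n i * x (n + 1 - i) else 0)"
        by (cases "k = n") (simp_all add: top_row_def in_tri_def)
    qed
    also have "\<dots> = (\<Sum>i=1..n. a n i * x i) + (\<Sum>i=1..n. b n i * x (n + 1 - i))"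
      using n by (simp add: sum.distrib)
    also have "(\<Sum>i=1..n. b n i * x (n + 1 - i)) = (\<Sum>i=1..n. b n (n + 1 - i) * x (n + 1 - (n + 1 - i)))"
      by (rule sum.atLeastAtMost_rev)
    also have "\<dots> = (\<Sum>i=1..n. - (a n i * x i))"
      using top by (intro sum.cong) auto
    finally show ?thesis
      by (simp add: sum_negf)
  qed
  then show ?thesis
    using tri by (auto simp: Lie_G_perp_def Lie_G_def)
qed

section \<open>The symplectomorphism\<close>

lemma gF_nth: "gF F $ i $ j = cnj (F $ i $ j)"
  by (simp add: gF_def adj_def)

lemma adj_adj [simp]: "adj (adj X) = X"
  by (simp add: adj_def vec_eq_iff)

lemma unitary_adj: "unitary (adj g) \<longleftrightarrow> unitary g"
  by (auto simp: unitary_def)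

lemma matrix_inv_right: "invertible A \<Longrightarrow> A ** matrix_inv A = mat 1"
  unfolding invertible_def matrix_inv_def by (rule someI2_ex) auto

lemma matrix_inv_unitary:
  assumes "unitary g"
  shows "matrix_inv g = adj g"
proof -
  have g: "adj g ** g = mat 1" "g ** adj g = mat 1"
    using assms by (simp_all add: unitary_def)
  then have "g ** matrix_inv g = mat 1"
    by (intro matrix_inv_right) (auto simp: invertible_def)
  then have "adj g ** (g ** matrix_inv g) = adj g"
    by simp
  then show ?thesis
    by (simp add: matrix_mul_assoc g)
qed

text \<open>The first component is forced: by \<open>framed_space_diagonalized\<close> the frame
  determines \<open>A\<close>.\<close>

definition Psi_inv :: "('n::finite \<Rightarrow> real) \<Rightarrow> 'n cmat \<times> 'n cmat \<Rightarrow> 'n framed_point" where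
  "Psi_inv lam = (\<lambda>(g, B). (adj g ** diag lam ** g, (\<chi> i j. cnj (g $ i $ j)), B))"

text \<open>Orthonormality of the frame is one of the two identities; for square matrices it implies
  the other.\<close>

lemma framed_space_unitary:
  assumes "(A, F, B) \<in> framed_space lam"
  shows "unitary (gF F)"
proof -
  have "gF F ** adj (gF F) = mat 1"
    using assms by (simp add: framed_space_def vec_eq_iff matrix_matrix_mult_def mat_def adj_def gF_nth)
  then show ?thesis
    unfolding unitary_def using matrix_left_right_inverse by blast
qed

text \<open>The eigenvector equations are the columns of
  \<open>A ** adj g = adj g ** diag lam\<close>, where \<open>g = gF F\<close> is unitary.\<close>

lemma framed_space_diagonalized:
  assumes "(A, F, B) \<in> framed_space lam"
  shows "A = adj (gF F) ** diag lam ** gF F"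
proof -
  have "A ** adj (gF F) = adj (gF F) ** diag lam"
  proof -
    have "(A *v (F $ i)) $ j = of_real (lam i) * F $ i $ j" for i j
      using assms by (simp add: framed_space_def)
    then show ?thesis
      by (simp add: vec_eq_iff matrix_matrix_mult_def matrix_vector_mult_def diag_def adj_def gF_nth
          if_distrib[of "\<lambda>x. _ * x"] sum.delta mult.commute cong: if_cong)
  qed
  then have "A ** (adj (gF F) ** gF F) = adj (gF F) ** diag lam ** gF F"
    by (simp add: matrix_mul_assoc)
  then show ?thesis
    using framed_space_unitary[OF assms] by (simp add: unitary_def)
qed

lemma Psi_mem: "p \<in> framed_space lam \<Longrightarrow> Psi p \<in> cotangent_U"
  by (cases p) (auto simp: Psi_def cotangent_U_def framed_space_unitary, simp add: framed_space_def)

lemma Psi_inv_Psi: "p \<in> framed_space lam \<Longrightarrow> Psi_inv lam (Psi p) = p"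
  by (cases p) (simp add: Psi_inv_def Psi_def gF_nth framed_space_diagonalized[symmetric] vec_lambda_eta)

lemma Psi_Psi_inv: "Psi (Psi_inv lam q) = q"
  by (cases q) (simp add: Psi_inv_def Psi_def gF_nth vec_eq_iff)

lemma Psi_inv_mem:
  assumes "q \<in> cotangent_U"
  shows "Psi_inv lam q \<in> framed_space lam"
proof -
  obtain g B where q: "q = (g, B)" "unitary g" "hermitian B"
    using assms by (auto simp: cotangent_U_def)
  let ?F = "\<chi> i j. cnj (g $ i $ j)"
  let ?A = "adj g ** diag lam ** g"
  have "(\<Sum>l\<in>UNIV. cnj (?F $ i $ l) * ?F $ j $ l) = (g ** adj g) $ i $ j" for i j
    by (simp add: matrix_matrix_mult_def adj_def)
  moreover have "?A *v (?F $ i) = of_real (lam i) *s (?F $ i)" for i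
  proof -
    have "?A ** adj g = adj g ** diag lam"
      using q(2) by (simp add: unitary_def flip: matrix_mul_assoc)
    then have "(?A ** adj g) $ j $ i = (adj g ** diag lam) $ j $ i" for j
      by simp
    moreover have "(?A *v (?F $ i)) $ j = (?A ** adj g) $ j $ i" for j
    proof -
      have "(M *v (?F $ i)) $ j = (M ** adj g) $ j $ i" for M :: "'a cmat"
        by (simp add: matrix_vector_mult_def matrix_matrix_mult_def adj_def)
      then show ?thesis .
    qed
    moreover have "(adj g ** diag lam) $ j $ i = of_real (lam i) * ?F $ i $ j" for j
      by (simp add: matrix_matrix_mult_def diag_def adj_def
          if_distrib[of "\<lambda>x. _ * x"] sum.delta mult.commute cong: if_cong)
    ultimately show ?thesis
      by (simp add: vec_eq_iff)
  qed
  moreover have "\<exists>U. unitary U \<and> ?A = U ** diag lam ** adj U"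
    using q(2) by (intro exI[of _ "adj g"]) (simp add: unitary_adj)
  ultimately show ?thesis
    using q by (simp add: framed_space_def Psi_inv_def unitary_def mat_def)
qed

lemma Psi_inv_mem_sreg: "q \<in> cotangent_sreg \<Longrightarrow> Psi_inv lam q \<in> framed_sreg lam"
  by (simp add: framed_sreg_def Psi_Psi_inv) (simp add: Psi_inv_mem cotangent_sreg_def)

lemma bij_betw_Psi: "bij_betw Psi (framed_sreg lam) cotangent_sreg"
  by (rule bij_betw_byWitness[where f' = "Psi_inv lam"])
    (auto simp: Psi_inv_mem_sreg Psi_Psi_inv, auto simp: framed_sreg_def Psi_inv_Psi)

lemma the_inv_into_Psi:
  assumes "q \<in> cotangent_sreg"
  shows "the_inv_into (framed_sreg lam) Psi q = Psi_inv lam q"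
  using bij_betw_Psi[of lam] assms
  by (intro the_inv_into_f_eq) (auto simp: bij_betw_def Psi_Psi_inv Psi_inv_mem_sreg)

section \<open>Smoothness of the identification and of its inverse\<close>

text \<open>The transposition in \<open>gF\<close> cancels against the one in \<open>adj\<close>,
  leaving entrywise conjugation, which is linear over the reals.\<close>

lemma bounded_linear_gF: "bounded_linear gF"
  by (rule linear_conv_bounded_linear[THEN iffD1], rule linearI)
    (simp_all add: vec_eq_iff gF_nth)

lemma bounded_linear_Psi: "bounded_linear Psi"
  by (rule linear_conv_bounded_linear[THEN iffD1], rule linearI)
    (auto simp: Psi_def linear_add[OF bounded_linear.linear[OF bounded_linear_gF]]
      linear_scale[OF bounded_linear.linear[OF bounded_linear_gF]])

lemma Ck_on_const: "Ck_on k U (\<lambda>_. c)"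
proof (induction k arbitrary: c)
  case (Suc k)
  then show ?case
    by (auto intro!: exI[of _ "\<lambda>_ _. 0"] derivative_intros)
qed simp

lemma Ck_on_affine:
  assumes "bounded_linear f"
  shows "Ck_on k U (\<lambda>x. f x + c)"
proof (cases k)
  case 0
  then show ?thesis
    by (simp add: continuous_on_add linear_continuous_on[OF assms] continuous_on_const)
next
  case (Suc k)
  have "((\<lambda>x. f x + c) has_derivative f) (at x)" for x
    using has_derivative_add_const[OF bounded_linear_imp_has_derivative[OF assms]] .
  then show ?thesis
    unfolding Suc Ck_on.simps using Ck_on_const by (intro exI[of _ "\<lambda>_. f"]) auto
qed

text \<open>Each directional derivative is affine. \<open>Psi_inv\<close> has this form: its first
  component is quadratic in \<open>g\<close> over the reals, the others are linear.\<close>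

lemma Ck_on_quadratic:
  assumes b: "bounded_bilinear b" and f: "bounded_linear f"
  shows "Ck_on k U (\<lambda>x. b x x + f x)"
proof (cases k)
  case 0
  then show ?thesis
    by (simp add: continuous_on_add linear_continuous_on[OF f] bounded_bilinear.continuous_on[OF b])
next
  case (Suc k)
  have "((\<lambda>x. b x x + f x) has_derivative (\<lambda>v. (b x v + b v x) + f v)) (at x)" for x
    by (intro has_derivative_add bounded_bilinear.FDERIV[OF b] has_derivative_ident
        bounded_linear_imp_has_derivative f)
  moreover have "Ck_on k U (\<lambda>x. (b x v + b v x) + f v)" for v
    by (intro Ck_on_affine bounded_linear_add bounded_bilinear.bounded_linear_left[OF b]
        bounded_bilinear.bounded_linear_right[OF b])
  ultimately show ?thesis
    unfolding Suc Ck_on.simps by (intro exI[of _ "\<lambda>x v. (b x v + b v x) + f v"]) auto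
qed

lemma smooth_map_Psi: "smooth_map S Psi"
  unfolding smooth_map_def
  using Ck_on_affine[OF bounded_linear_Psi, of _ UNIV 0] by (intro exI[of _ UNIV] exI[of _ Psi]) auto

lemma smooth_map_Psi_inv: "smooth_map S (Psi_inv lam)"
proof -
  define b :: "'a cmat \<times> 'a cmat \<Rightarrow> 'a cmat \<times> 'a cmat \<Rightarrow> 'a framed_point"
    where "b = (\<lambda>p q. (adj (fst p) ** diag lam ** fst q, 0, 0))"
  define f :: "'a cmat \<times> 'a cmat \<Rightarrow> 'a framed_point"
    where "f = (\<lambda>q. (0, (\<chi> i j. cnj (fst q $ i $ j)), snd q))"
  have "bounded_bilinear b"
    unfolding bilinear_conv_bounded_bilinear[symmetric] bilinear_def b_def
    by (auto intro!: linearI simp: matrix_matrix_mult_def adj_def vec_eq_iff sum.distrib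
        sum_distrib_left sum_distrib_right distrib_left distrib_right scaleR_conv_of_real[where 'a = complex] mult_ac)
  moreover have "bounded_linear f"
    unfolding f_def
    by (rule linear_conv_bounded_linear[THEN iffD1], rule linearI) (auto simp: vec_eq_iff)
  ultimately have "Ck_on k UNIV (\<lambda>q. b q q + f q)" for k
    by (rule Ck_on_quadratic)
  moreover have "Psi_inv lam q = b q q + f q" for q
    by (cases q) (simp add: Psi_inv_def b_def f_def)
  ultimately show ?thesis
    unfolding smooth_map_def by (intro exI[of _ UNIV] exI[of _ "\<lambda>q. b q q + f q"]) auto
qed

lemma smooth_map_cong: "(\<And>x. x \<in> S \<Longrightarrow> f x = g x) \<Longrightarrow> smooth_map S f \<longleftrightarrow> smooth_map S g"
  by (simp add: smooth_map_def)

text \<open>A derivative within \<open>S\<close> need not be unique, but the chain rule along curves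
  in \<open>S\<close> determines it on tangent vectors.\<close>

lemma derivative_within_eq_on_tangent:
  assumes f': "(f has_derivative f') (at p within S)" and D: "(f has_derivative D) (at p)"
    and v: "v \<in> tangent S p"
  shows "f' v = D v"
proof -
  from v obtain c where c: "c 0 = p" "\<forall>\<^sub>F t in nhds 0. c t \<in> S" "(c has_vector_derivative v) (at (0::real))"
    unfolding tangent_def mem_Collect_eq by (elim exE conjE)
  from c(2)[unfolded eventually_nhds] obtain T where T: "open T" "0 \<in> T" "\<forall>t\<in>T. c t \<in> S"
    by (elim exE conjE)
  have within: "at 0 within T = at 0"
    by (rule at_within_open[OF T(2,1)])
  have c': "(c has_vector_derivative v) (at 0 within T)"
    unfolding within by (rule c(3))
  have "c ` T \<subseteq> S"
    using T(3) by blast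
  then have "(f \<circ> c has_vector_derivative f' v) (at 0 within T)"
    by (intro vector_derivative_diff_chain_within[OF c'] has_derivative_subset[OF f'[folded c(1)]])
  moreover have "(f \<circ> c has_vector_derivative D v) (at 0 within T)"
    by (rule vector_derivative_diff_chain_within[OF c' has_derivative_at_withinI[OF D[folded c(1)]]])
  ultimately show ?thesis
    unfolding within by (rule vector_derivative_unique_at)
qed

section \<open>Differentiability of the canonical one-form and its pullback\<close>

lemma differentiable_prod:
  fixes f :: "'i \<Rightarrow> 'a::real_normed_vector \<Rightarrow> 'b::real_normed_field"
  assumes "\<And>i. i \<in> I \<Longrightarrow> f i differentiable (at x within S)"
  shows "(\<lambda>x. \<Prod>i\<in>I. f i x) differentiable (at x within S)"
  using assms by (induction I rule: infinite_finite_induct) auto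

lemma differentiable_det:
  fixes f :: "'a::real_normed_vector \<Rightarrow> 'b::real_normed_field ^ 'n::finite ^ 'n"
  assumes "\<And>i j. (\<lambda>x. f x $ i $ j) differentiable (at x within S)"
  shows "(\<lambda>x. det (f x)) differentiable (at x within S)"
  unfolding det_def
  by (intro differentiable_sum differentiable_mult differentiable_const differentiable_prod assms ballI finite_permutations) simp

text \<open>Column \<open>k\<close> of the inverse solves a linear system with a unit vector on the
  right. The resulting formula for the entries can be differentiated.\<close>

lemma matrix_inv_cramer:
  fixes A :: "'a::field ^ 'n::finite ^ 'n"
  assumes "det A \<noteq> 0"
  shows "matrix_inv A $ l $ k = det (\<chi> i j. if j = l then if i = k then 1 else 0 else A $ i $ j) / det A"
proof -
  have "A ** matrix_inv A = mat 1"
    using assms by (simp add: matrix_inv_right invertible_det_nz)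
  then have "A *v (matrix_inv A *v axis k 1) = axis k 1"
    by (simp add: matrix_vector_mul_assoc)
  then have "matrix_inv A *v axis k 1 = (\<chi> l. det (\<chi> i j. if j = l then axis k 1 $ i else A $ i $ j) / det A)"
    using cramer[OF assms] by blast
  then have "(matrix_inv A *v axis k 1) $ l = det (\<chi> i j. if j = l then axis k 1 $ i else A $ i $ j) / det A"
    by simp
  then show ?thesis
    by (simp add: matrix_vector_mult_def axis_def if_distrib[of "\<lambda>x. _ * x"] sum.delta cong: if_cong)
qed

text \<open>The chain rule for \<open>frechet_derivative\<close> requires this. Cramer's rule
  replaces the inverse by a quotient of determinants, with the same values on the open set of
  invertible matrices.\<close>

lemma theta_T_differentiable:
  assumes "unitary g"
  shows "(\<lambda>q. theta_T q w) differentiable (at (g, B))"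
proof -
  define inv' :: "'a cmat \<Rightarrow> 'a \<Rightarrow> 'a \<Rightarrow> complex" where
    "inv' A l k = det (\<chi> i j. if j = l then if i = k then 1 else 0 else A $ i $ j) / det A" for A l k
  define h :: "'a cmat \<times> 'a cmat \<Rightarrow> real" where
    "h q = Re (\<i> * (\<Sum>i\<in>UNIV. \<Sum>k\<in>UNIV. (\<Sum>l\<in>UNIV. snd q $ i $ l * inv' (fst q) l k) * fst w $ k $ i))" for q
  have det_g: "det g \<noteq> 0"
    using assms unfolding unitary_def by (metis invertible_def invertible_det_nz)
  let ?U = "{q :: 'a cmat \<times> 'a cmat. det (fst q) \<noteq> 0}"
  have entry1: "(\<lambda>q. fst q $ i $ j) differentiable F" and entry2: "(\<lambda>q. snd q $ i $ j) differentiable F"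
    for i j :: 'a and F :: "('a cmat \<times> 'a cmat) filter"
    by (intro bounded_linear_imp_differentiable bounded_linear_compose[OF bounded_linear_vec_nth]
        bounded_linear_fst bounded_linear_snd)+
  have "continuous_on UNIV (\<lambda>q :: 'a cmat \<times> 'a cmat. det (fst q))"
    unfolding det_def by (intro continuous_intros)
  then have "open ?U"
    by (intro open_Collect_neq continuous_on_const)
  have "(\<lambda>q. inv' (fst q) l k) differentiable (at (g, B))" for l k
    unfolding inv'_def
  proof (intro differentiable_divide differentiable_det)
    show "(\<lambda>q. (\<chi> i j. if j = l then if i = k then 1 else 0 else fst q $ i $ j) $ i $ j)
        differentiable (at (g, B))" for i j
      using entry1 by (cases "j = l") simp_all
  qed (use entry1 det_g in auto)
  then have "h differentiable (at (g, B))"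
    unfolding h_def
    by (intro differentiable_compose[OF bounded_linear_imp_differentiable[OF bounded_linear_Re]]
        differentiable_mult differentiable_sum differentiable_const entry2 ballI) auto
  then obtain D where D: "(h has_derivative D) (at (g, B))"
    unfolding differentiable_def by blast
  have "h q = theta_T q w" if "q \<in> ?U" for q
  proof -
    have "matrix_inv (fst q) $ l $ k = inv' (fst q) l k" for l k
      using that unfolding inv'_def by (intro matrix_inv_cramer) simp
    then show ?thesis
      by (cases q; cases w) (simp add: h_def theta_T_def trace_def matrix_matrix_mult_def)
  qed
  from has_derivative_transform_within_open[OF D \<open>open ?U\<close> _ this] show ?thesis
    unfolding differentiable_def using det_g by auto
qed

text \<open>Being linear, \<open>gF\<close> is its own derivative; so \<open>theta_M\<close> is the
  pullback of \<open>theta_T\<close> under \<open>Psi\<close>.\<close>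

lemma theta_M_eq:
  fixes q w :: "'n::finite framed_point"
  shows "theta_M q w = theta_T (Psi q) (Psi w)"
proof -
  have "frechet_derivative gF (at F) = gF" for F :: "'n cmat"
    using frechet_derivative_at[OF bounded_linear_imp_has_derivative[OF bounded_linear_gF]] by metis
  then show ?thesis
    by (cases q; cases w) (simp add: theta_M_def theta_T_def Psi_def)
qed

text \<open>The linear map \<open>Psi\<close> takes constant vector fields to constant ones, so the
  chain rule alone shows that the exterior derivative commutes with the pullback.\<close>

lemma ext_deriv_theta_M:
  assumes p: "p \<in> framed_space lam"
  shows "ext_deriv theta_M p v w = ext_deriv theta_T (Psi p) (Psi v) (Psi w)"
proof -
  have "frechet_derivative (\<lambda>q. theta_M q w) (at p) v
      = frechet_derivative (\<lambda>q. theta_T q (Psi w)) (at (Psi p)) (Psi v)" for v w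
  proof -
    have "unitary (fst (Psi p))"
      using Psi_mem[OF p] by (auto simp: cotangent_U_def)
    then have "(\<lambda>q. theta_T q (Psi w)) differentiable (at (Psi p))"
      using theta_T_differentiable[of "fst (Psi p)" "Psi w" "snd (Psi p)"] by simp
    then have "((\<lambda>q. theta_T q (Psi w)) has_derivative
        frechet_derivative (\<lambda>q. theta_T q (Psi w)) (at (Psi p))) (at (Psi p))"
      by (simp add: frechet_derivative_works)
    then have "((\<lambda>q. theta_T (Psi q) (Psi w)) has_derivative
        (\<lambda>v. frechet_derivative (\<lambda>q. theta_T q (Psi w)) (at (Psi p)) (Psi v))) (at p)"
      by (rule has_derivative_compose[OF bounded_linear_imp_has_derivative[OF bounded_linear_Psi]])
    from frechet_derivative_at[OF this] show ?thesis
      unfolding theta_M_eq by metis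
  qed
  then show ?thesis
    by (simp add: ext_deriv_def)
qed

lemma symplectomorphism_Psi:
  "symplectomorphism (framed_sreg lam) (ext_deriv theta_M) cotangent_sreg (ext_deriv theta_T) Psi"
  unfolding symplectomorphism_def
proof (intro conjI ballI allI impI)
  show "smooth_map cotangent_sreg (the_inv_into (framed_sreg lam) Psi)"
    using smooth_map_Psi_inv by (subst smooth_map_cong[OF the_inv_into_Psi])
  fix p f' v w
  assume p: "p \<in> framed_sreg lam" and f': "(Psi has_derivative f') (at p within framed_sreg lam)"
    and vw: "v \<in> tangent (framed_sreg lam) p" "w \<in> tangent (framed_sreg lam) p"
  have "f' v = Psi v" "f' w = Psi w"
    using derivative_within_eq_on_tangent[OF f' bounded_linear_imp_has_derivative[OF bounded_linear_Psi]] vw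
    by auto
  then show "ext_deriv theta_T (Psi p) (f' v) (f' w) = ext_deriv theta_M p v w"
    using p by (simp add: framed_sreg_def ext_deriv_theta_M[of p lam])
qed (rule bij_betw_Psi smooth_map_Psi)+

section \<open>Identification of the spectral system with the double Gelfand--Zeitlin system\<close>

lemma phi_spec_eq_double_GZ:
  fixes lam :: "'n::{finite,linorder} \<Rightarrow> real"
  assumes fam: "caterpillar_family lam u La" and p: "(A, F, B) \<in> framed_sreg lam"
  shows "phi_spec u La (A, F, B) = (mu (gF F ** B ** matrix_inv (gF F)), mu (- B))"
    and "phi_spec u La (A, F, B) \<in> Lie_G_perp CARD('n)"
    and "phi_spec u La (A, F, B) = double_GZ (Psi (A, F, B))"
proof -
  have g: "unitary (gF F)"
    using p framed_space_unitary by (auto simp: framed_sreg_def)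
  note inv = matrix_inv_unitary[OF g]
  have "strictly_interlacing (gF F ** B ** adj (gF F))" "strictly_interlacing (- B)"
    using p by (simp_all add: framed_sreg_def cotangent_sreg_def Psi_def moment_map_def coadjoint_def inv)
  then have phi: "phi_spec u La (A, F, B) = (mu (gF F ** B ** adj (gF F)), mu (- B))"
    by (rule phi_spec_eq_mu[OF fam g])
  then show "phi_spec u La (A, F, B) = (mu (gF F ** B ** matrix_inv (gF F)), mu (- B))"
    "phi_spec u La (A, F, B) = double_GZ (Psi (A, F, B))"
    by (simp_all add: inv double_GZ_def moment_map_def Psi_def coadjoint_def)
  have "mu X \<in> tri_space CARD('n)" for X :: "'n cmat"
    by (simp add: tri_space_def mu_def)
  then show "phi_spec u La (A, F, B) \<in> Lie_G_perp CARD('n)"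
    unfolding phi using mu_top_row_uminus_conj[OF g] by (intro mem_Lie_G_perpI) (simp_all add: Suc_le_eq)
qed

theorem theorem1p1:
  fixes lam :: "'n::{finite,linorder} \<Rightarrow> real"
    and u La :: "nat \<Rightarrow> 'n \<Rightarrow> real"
  assumes "inj lam"
    and "caterpillar_family lam u La"
  shows
    "symplectomorphism (framed_sreg lam) (ext_deriv theta_M) cotangent_sreg (ext_deriv theta_T) Psi
     \<and> (\<forall>(A, F, B) \<in> framed_sreg lam.
          phi_spec u La (A, F, B) = (mu (gF F ** B ** matrix_inv (gF F)), mu (- B)))
     \<and> phi_spec u La ` framed_sreg lam \<subseteq> Lie_G_perp CARD('n)
     \<and> (\<forall>p \<in> framed_sreg lam. phi_spec u La p = double_GZ (Psi p))"
proof (intro conjI ballI)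
  show "symplectomorphism (framed_sreg lam) (ext_deriv theta_M) cotangent_sreg (ext_deriv theta_T) Psi"
    by (rule symplectomorphism_Psi)
qed (use phi_spec_eq_double_GZ[OF assms(2)] in \<open>auto simp: split_beta\<close>)

end
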